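(* For an SCC $F:\Theta\to 2^Z\setminus\{\emptyset\}$ the following are equivalent: (i) $F$ is mixed-Nash-A-implementable; (ii) $F$ is mixed-Nash-B-implementable; (iii) $\widehat{\mathcal L}^{Y\text{-}A\text{-}B}$-uniform-monotonicity holds for $F$.
   Context: Standing setup: $\mathcal I=\{1,\dots,I\}$ finite, $I\ge 3$; $\Theta$ finite or countably infinite; $Z$ finite; $Y=\Delta(Z)$ with $z\in Z$ identified with degenerate lotteries; $u_i^\theta:Z\to\mathbb R$, $U_i^\theta(y)=\sum_zy_zu_i^\theta(z)$; $\mathcal L_i^Y(\alpha,\theta)=\{y\in Y:U_i^\theta(\alpha)\ge U_i^\theta(y)\}$, $\mathcal L_i^Z(\alpha,\theta)=\{z\in Z:U_i^\theta(\alpha)\ge u_i^\theta(z)\}$, and for nonempty $E\subseteq Z$, $\mathcal L_i^Z(E,\theta)=\bigcap_{z\in E}\mathcal L_i^Z(z,\theta)$. UNIF$(E)$ is the uniform lottery on $E$. Mechanisms, $PNE^{(\mathcal M,\theta)}$, $MNE^{(\mathcal M,\theta)}$ and induced lotteries $g(\lambda)$ are as usual (countable message sets, expected utility). Mixed-Nash-A-implementable: some $\mathcal M$ has $\bigcup_{\lambda\in MNE^{(\mathcal M,\theta)}}\mathrm{SUPP}(g[\lambda])=F(\theta)$ for all $\theta$; mixed-Nash-B-implementable: some $\mathcal M$ has $\bigcup_{\lambda\in MNE}\mathrm{SUPP}(g[\lambda])=\bigcup_{\lambda\in PNE}\mathrm{SUPP}(g[\lambda])=F(\theta)$ for all $\theta$.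 A nonempty $E\subseteq Z$ is an $i$-max set if for some $\theta$, $E\subseteq\arg\max_{z\in E}u_i^\theta(z)$ and $E\subseteq\arg\max_{z\in Z}u_j^\theta(z)$ for all $j\ne i$. $Z^*=\bigcup_\theta F(\theta)$ if $Z$ is an $i$-max set for some $i$, else $Z^*=Z$. A nonempty $E\subseteq Z^*$ is an $i$-$Z^*$-$\theta$-max set if $E\subseteq\arg\max_{z\in E}u_i^\theta(z)$ and $E\subseteq\arg\max_{z\in Z^*}u_j^\theta(z)$ for all $j\ne i$; $\Lambda^{i}(E)=\{\theta\in\Theta:E\text{ is an }i\text{-}Z^*\text{-}\theta\text{-max set}\}$ (empty if $E=\emptyset$), and $E$ is an $i$-$Z^*$-max set if $\Lambda^i(E)\neq\emptyset$. $\Theta_i^\theta=\{\theta'\in\Theta:F(\theta)\text{ is an }i\text{-}Z^*\text{-}\theta'\text{-max set and }F(\theta)\subseteq F(\theta')\}$. $\Xi_i(\theta)=\{K\subseteq\Theta_i^\theta,K\ne\emptyset:\Theta_i^\theta\cap\Lambda^i\big(Z^*\cap\mathcal L_i^Z(F(\theta),\theta)\cap\bigcap_{\theta'\in K}F(\theta')\big)=K\}$. Define $\widehat{\mathcal L}_i^{Y\text{-}A\text{-}B}(\mathrm{UNIF}[F(\theta)],\theta)=\Delta\big[Z^*\cap\mathcal L_i^Z(F(\theta),\theta)\cap\bigcup_{K\in\Xi_i(\theta)}\bigcap_{\theta'\in K}F(\theta')\big]$ if $F(\theta)\subseteq\arg\min_{z\in Z^*}u_i^\theta(z)$, $\Xi_i(\theta)\ne\emptyset$,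 and $Z^*\cap\mathcal L_i^Z(F(\theta),\theta)$ is an $i$-$Z^*$-max set; otherwise it equals $\Delta(Z^* )\cap\mathcal L_i^Y(\mathrm{UNIF}[F(\theta)],\theta)$. $\widehat{\mathcal L}^{Y\text{-}A\text{-}B}$-uniform-monotonicity holds if for all $\theta,\theta'\in\Theta$: [$\widehat{\mathcal L}_i^{Y\text{-}A\text{-}B}(\mathrm{UNIF}[F(\theta)],\theta)\subseteq\mathcal L_i^Y(\mathrm{UNIF}[F(\theta)],\theta')$ for all $i$] implies $F(\theta)\subseteq F(\theta')$. *)

theory Defs
  imports "HOL-Probability.Probability"
begin

(* Agents: a finite type 'i.  States: a countable type 'th.  Outcomes: a finite type 'z.
   Lotteries Y = Delta(Z): the type 'z pmf.  Utilities u i th z = u_i^th(z). *)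

definition EU :: "('z::finite \<Rightarrow> real) \<Rightarrow> 'z pmf \<Rightarrow> real" where
  "EU v p = (\<Sum>z\<in>UNIV. pmf p z * v z)"

definition Delta :: "'z set \<Rightarrow> 'z pmf set" where
  "Delta E = {p. set_pmf p \<subseteq> E}"

definition argmax_on :: "('z \<Rightarrow> real) \<Rightarrow> 'z set \<Rightarrow> 'z set" where
  "argmax_on v S = {z\<in>S. \<forall>z'\<in>S. v z' \<le> v z}"

definition argmin_on :: "('z \<Rightarrow> real) \<Rightarrow> 'z set \<Rightarrow> 'z set" where
  "argmin_on v S = {z\<in>S. \<forall>z'\<in>S. v z \<le> v z'}"

definition LY :: "('z::finite \<Rightarrow> real) \<Rightarrow> 'z pmf \<Rightarrow> 'z pmf set" where
  "LY v a = {y. EU v a \<ge> EU v y}"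

definition LZ :: "('z::finite \<Rightarrow> real) \<Rightarrow> 'z pmf \<Rightarrow> 'z set" where
  "LZ v a = {z. EU v a \<ge> v z}"

definition LZset :: "('z::finite \<Rightarrow> real) \<Rightarrow> 'z set \<Rightarrow> 'z set" where
  "LZset v E = (\<Inter>z\<in>E. LZ v (return_pmf z))"

definition imax_set :: "('i \<Rightarrow> 'th \<Rightarrow> 'z \<Rightarrow> real) \<Rightarrow> 'i \<Rightarrow> 'z set \<Rightarrow> bool" where
  "imax_set u i E \<longleftrightarrow> E \<noteq> {} \<and> (\<exists>th. E \<subseteq> argmax_on (u i th) E \<and>
      (\<forall>j. j \<noteq> i \<longrightarrow> E \<subseteq> argmax_on (u j th) UNIV))"

definition Zstar :: "('i \<Rightarrow> 'th \<Rightarrow> 'z \<Rightarrow> real) \<Rightarrow> ('th \<Rightarrow> 'z set) \<Rightarrow> 'z set" where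
  "Zstar u F = (if \<exists>i. imax_set u i UNIV then (\<Union>th. F th) else UNIV)"

definition iZmax :: "('i \<Rightarrow> 'th \<Rightarrow> 'z \<Rightarrow> real) \<Rightarrow> ('th \<Rightarrow> 'z set) \<Rightarrow> 'i \<Rightarrow> 'th \<Rightarrow> 'z set \<Rightarrow> bool" where
  "iZmax u F i th E \<longleftrightarrow> E \<noteq> {} \<and> E \<subseteq> Zstar u F \<and> E \<subseteq> argmax_on (u i th) E \<and>
      (\<forall>j. j \<noteq> i \<longrightarrow> E \<subseteq> argmax_on (u j th) (Zstar u F))"

definition Lam :: "('i \<Rightarrow> 'th \<Rightarrow> 'z \<Rightarrow> real) \<Rightarrow> ('th \<Rightarrow> 'z set) \<Rightarrow> 'i \<Rightarrow> 'z set \<Rightarrow> 'th set" where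
  "Lam u F i E = {th. iZmax u F i th E}"

definition ThetaI :: "('i \<Rightarrow> 'th \<Rightarrow> 'z \<Rightarrow> real) \<Rightarrow> ('th \<Rightarrow> 'z set) \<Rightarrow> 'i \<Rightarrow> 'th \<Rightarrow> 'th set" where
  "ThetaI u F i th = {th'. iZmax u F i th' (F th) \<and> F th \<subseteq> F th'}"

definition Xi :: "('i \<Rightarrow> 'th \<Rightarrow> 'z::finite \<Rightarrow> real) \<Rightarrow> ('th \<Rightarrow> 'z set) \<Rightarrow> 'i \<Rightarrow> 'th \<Rightarrow> 'th set set" where
  "Xi u F i th = {K. K \<subseteq> ThetaI u F i th \<and> K \<noteq> {} \<and>
      ThetaI u F i th \<inter> Lam u F i (Zstar u F \<inter> LZset (u i th) (F th) \<inter> (\<Inter>th'\<in>K. F th')) = K}"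

definition Lhat :: "('i \<Rightarrow> 'th \<Rightarrow> 'z::finite \<Rightarrow> real) \<Rightarrow> ('th \<Rightarrow> 'z set) \<Rightarrow> 'i \<Rightarrow> 'th \<Rightarrow> 'z pmf set" where
  "Lhat u F i th =
     (if F th \<subseteq> argmin_on (u i th) (Zstar u F) \<and> Xi u F i th \<noteq> {} \<and>
         Lam u F i (Zstar u F \<inter> LZset (u i th) (F th)) \<noteq> {}
      then Delta (Zstar u F \<inter> LZset (u i th) (F th) \<inter> (\<Union>K\<in>Xi u F i th. \<Inter>th'\<in>K. F th'))
      else Delta (Zstar u F) \<inter> LY (u i th) (pmf_of_set (F th)))"

definition unif_mono :: "('i \<Rightarrow> 'th \<Rightarrow> 'z::finite \<Rightarrow> real) \<Rightarrow> ('th \<Rightarrow> 'z set) \<Rightarrow> bool" where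
  "unif_mono u F \<longleftrightarrow> (\<forall>th th'. (\<forall>i. Lhat u F i th \<subseteq> LY (u i th') (pmf_of_set (F th))) \<longrightarrow> F th \<subseteq> F th')"

(* Mechanisms: countable message sets, w.l.o.g. nonempty subsets M i of nat;
   outcome function g maps message profiles to lotteries. *)

definition induced :: "(('i::finite \<Rightarrow> nat) \<Rightarrow> 'z pmf) \<Rightarrow> ('i \<Rightarrow> nat pmf) \<Rightarrow> 'z pmf" where
  "induced g lam = bind_pmf (Pi_pmf UNIV 0 lam) g"

definition MNE :: "('i::finite \<Rightarrow> nat set) \<Rightarrow> (('i \<Rightarrow> nat) \<Rightarrow> 'z::finite pmf) \<Rightarrow>
    ('i \<Rightarrow> 'th \<Rightarrow> 'z \<Rightarrow> real) \<Rightarrow> 'th \<Rightarrow> ('i \<Rightarrow> nat pmf) set" where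
  "MNE M g u th = {lam. (\<forall>i. set_pmf (lam i) \<subseteq> M i) \<and>
      (\<forall>i mu. set_pmf mu \<subseteq> M i \<longrightarrow>
         EU (u i th) (induced g lam) \<ge> EU (u i th) (induced g (lam(i := mu))))}"

definition PNE :: "('i::finite \<Rightarrow> nat set) \<Rightarrow> (('i \<Rightarrow> nat) \<Rightarrow> 'z::finite pmf) \<Rightarrow>
    ('i \<Rightarrow> 'th \<Rightarrow> 'z \<Rightarrow> real) \<Rightarrow> 'th \<Rightarrow> ('i \<Rightarrow> nat) set" where
  "PNE M g u th = {m. (\<forall>i. m i \<in> M i) \<and>
      (\<forall>i m'. m' \<in> M i \<longrightarrow> EU (u i th) (g m) \<ge> EU (u i th) (g (m(i := m'))))}"

definition mixedA_impl :: "('i::finite \<Rightarrow> 'th \<Rightarrow> 'z::finite \<Rightarrow> real) \<Rightarrow> ('th \<Rightarrow> 'z set) \<Rightarrow> bool" where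
  "mixedA_impl u F \<longleftrightarrow> (\<exists>(M :: 'i \<Rightarrow> nat set) g. (\<forall>i. M i \<noteq> {}) \<and>
      (\<forall>th. (\<Union>lam\<in>MNE M g u th. set_pmf (induced g lam)) = F th))"

definition mixedB_impl :: "('i::finite \<Rightarrow> 'th \<Rightarrow> 'z::finite \<Rightarrow> real) \<Rightarrow> ('th \<Rightarrow> 'z set) \<Rightarrow> bool" where
  "mixedB_impl u F \<longleftrightarrow> (\<exists>(M :: 'i \<Rightarrow> nat set) g. (\<forall>i. M i \<noteq> {}) \<and>
      (\<forall>th. (\<Union>lam\<in>MNE M g u th. set_pmf (induced g lam)) = F th \<and>
            (\<Union>m\<in>PNE M g u th. set_pmf (g m)) = F th))"

end

theory Submission
  imports Defs
begin

text \<open>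
  Necessity: a mixed equilibrium at \<open>\<theta>\<close> remains one at \<open>\<theta>'\<close>. In the exceptional case the set
  \<open>C\<close> of outcomes that agent \<open>i\<close> can reach by deviating lies in the lower contour set of
  \<open>F(\<theta>)\<close>, and \<open>C \<subseteq> F(\<theta>'')\<close> for every \<open>\<theta>''\<close> at which \<open>C\<close> is an \<open>i\<close>-\<open>Z*\<close>-max set, since there
  all those deviations are equilibria. These \<open>\<theta>''\<close> form a pre-fixed point of the monotone operator
  whose nonempty fixed points are \<open>\<Xi>\<^sub>i(\<theta>)\<close>, so its least fixed point \<open>K\<close> satisfies
  \<open>C \<subseteq> \<Inter>{F(t) | t \<in> K}\<close>.

  Sufficiency: agents name a state; a lone dissenter \<open>i\<close> from a consensus on \<open>\<theta>\<close> chooses from the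
  modified lower contour set, and with more disagreement the agent with the highest integer chooses
  from all lotteries on \<open>Z*\<close>. With probability \<open>1/(k+1)\<close> the choice is replaced by a fixed lottery
  that is optimal only for an agent who is indifferent on the whole menu. As any agent can escalate
  \<open>k\<close>, every profile in the support of a mixed equilibrium gives every agent the best lottery
  available against the others. Such a profile is a consensus on some \<open>\<theta>\<close> with \<open>F(\<theta>)\<close>
  contained in the true \<open>F\<close>, or it forces indifference, which makes the support of the menu
  a max set, hence again contained in the true \<open>F\<close>.
\<close>

section \<open>Expected utility\<close>

lemma EU_integral: "EU v p = measure_pmf.expectation p v"
  unfolding EU_def by (subst integral_measure_pmf_real[of UNIV]) (auto simp: mult.commute)

lemma EU_return [simp]: "EU v (return_pmf z) = v z"
  by (simp add: EU_integral)

lemma EU_zero [simp]: "EU (\<lambda>_. 0) p = 0"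
  by (simp add: EU_def)

lemma EU_abs_le: "\<bar>EU v p\<bar> \<le> (\<Sum>z\<in>UNIV. \<bar>v z\<bar>)"
  unfolding EU_def
  by (rule order_trans[OF sum_abs sum_mono])
     (simp add: abs_mult mult_left_le_one_le pmf_le_1)

lemma bounded_integrable_pmf:
  fixes f :: "'a \<Rightarrow> real"
  assumes "\<And>x. \<bar>f x\<bar> \<le> b"
  shows "integrable (measure_pmf p) f"
  using assms by (intro measure_pmf.integrable_const_bound[where B=b]) auto

lemma EU_bind: "EU v (bind_pmf P g) = measure_pmf.expectation P (\<lambda>x. EU v (g x))"
proof -
  have "integrable (measure_pmf P) (\<lambda>x. pmf (g x) z * v z)" for z
    by (rule integrable_mult_left) (auto intro: bounded_integrable_pmf[where b=1] simp: pmf_le_1)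
  then show ?thesis
    unfolding EU_def by (simp add: pmf_bind)
qed

lemma EU_pmf_integrable: "integrable (measure_pmf P) (\<lambda>x. EU v (g x))"
  by (rule bounded_integrable_pmf[OF EU_abs_le])

text \<open>The difference \<open>h - f\<close> is nonnegative on the support and has integral at
  most 0, so it vanishes almost everywhere; for a pmf this means at every point of the
  support.\<close>

lemma expectation_eq_pointwise:
  fixes f h :: "'a \<Rightarrow> real"
  assumes "integrable (measure_pmf P) f" "integrable (measure_pmf P) h"
    and le: "\<And>x. x \<in> set_pmf P \<Longrightarrow> f x \<le> h x"
    and ge: "measure_pmf.expectation P h \<le> measure_pmf.expectation P f"
    and "x \<in> set_pmf P"
  shows "f x = h x"
proof -
  have i: "integrable (measure_pmf P) (\<lambda>x. h x - f x)"
    using assms by auto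
  have nn: "AE x in measure_pmf P. 0 \<le> h x - f x"
    using le by (auto simp: AE_measure_pmf_iff)
  have "measure_pmf.expectation P (\<lambda>x. h x - f x) \<le> 0"
    using assms by simp
  moreover have "0 \<le> measure_pmf.expectation P (\<lambda>x. h x - f x)"
    using nn by (rule integral_nonneg_AE)
  ultimately have "AE x in measure_pmf P. h x - f x = 0"
    using integral_nonneg_eq_0_iff_AE[OF i nn] by linarith
  then show ?thesis
    using assms(5) by (auto simp: AE_measure_pmf_iff)
qed

lemma EU_bind_le:
  assumes "\<And>x. x \<in> set_pmf P \<Longrightarrow> EU v (g x) \<le> c"
  shows "EU v (bind_pmf P g) \<le> c"
proof -
  have "measure_pmf.expectation P (\<lambda>x. EU v (g x)) \<le> measure_pmf.expectation P (\<lambda>_. c)"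
    using assms by (intro integral_mono_AE EU_pmf_integrable) (auto simp: AE_measure_pmf_iff)
  then show ?thesis by (simp add: EU_bind)
qed

lemma EU_le:
  assumes "\<And>z. z \<in> set_pmf p \<Longrightarrow> v z \<le> c"
  shows "EU v p \<le> c"
  using EU_bind_le[of p v return_pmf c] assms by (simp add: bind_return_pmf')

lemma EU_uminus: "EU (\<lambda>z. - v z) p = - EU v p"
  by (simp add: EU_def sum_negf)

lemma EU_ge:
  assumes "\<And>z. z \<in> set_pmf p \<Longrightarrow> c \<le> v z"
  shows "c \<le> EU v p"
  using EU_le[of p "\<lambda>z. - v z" "- c"] assms by (simp add: EU_uminus)

lemma EU_const:
  assumes "\<And>z. z \<in> set_pmf p \<Longrightarrow> v z = c"
  shows "EU v p = c"
  using EU_le[of p v c] EU_ge[of p c v] assms by fastforce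

lemma EU_bind_max_imp_const:
  assumes "\<And>x. x \<in> set_pmf P \<Longrightarrow> EU v (g x) \<le> c" "c \<le> EU v (bind_pmf P g)" "x \<in> set_pmf P"
  shows "EU v (g x) = c"
  using assms by (intro expectation_eq_pointwise[where P=P and f="\<lambda>x. EU v (g x)" and h="\<lambda>_. c"])
    (auto simp: EU_bind EU_pmf_integrable)

lemma EU_max_imp_const:
  assumes "\<And>z. z \<in> set_pmf p \<Longrightarrow> v z \<le> c" "c \<le> EU v p" "z \<in> set_pmf p"
  shows "v z = c"
  using EU_bind_max_imp_const[of p v return_pmf c z] assms by (simp add: bind_return_pmf')

lemma EU_min_imp_const:
  assumes "\<And>z. z \<in> set_pmf p \<Longrightarrow> c \<le> v z" "EU v p \<le> c" "z \<in> set_pmf p"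
  shows "v z = c"
  using EU_max_imp_const[of p "\<lambda>z. - v z" "- c" z] assms by (simp add: EU_uminus)

lemma set_pmf_of_set_finite [simp]:
  fixes E :: "'z::finite set"
  shows "E \<noteq> {} \<Longrightarrow> set_pmf (pmf_of_set E) = E"
  by (simp add: set_pmf_of_set)

lemma LZset_eq: "LZset v E = {z. \<forall>w\<in>E. v z \<le> v w}"
  by (auto simp: LZset_def LZ_def)

section \<open>Uniform lower contour sets\<close>

text \<open>The perturbation has total mass 0. On \<open>E\<close> the uniform weight
  \<open>1 / card E\<close> absorbs the subtracted \<open>pmf p z / card E\<close>; outside
  \<open>E\<close> nothing is subtracted.\<close>

lemma ex_shifted_uniform:
  fixes E :: "'z::finite set"
  assumes "E \<noteq> {}" "set_pmf p \<subseteq> E"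
  obtains y where "\<And>z. pmf y z = pmf (pmf_of_set E) z + (pmf q z - pmf p z) / card E"
proof -
  define f where "f z = pmf (pmf_of_set E) z + (pmf q z - pmf p z) / card E" for z
  have c: "real (card E) > 0"
    using assms by (simp add: card_gt_0_iff)
  have nn: "0 \<le> f z" for z
  proof (cases "z \<in> E")
    case True
    then have "f z = (1 - pmf p z + pmf q z) / card E"
      using assms c by (simp add: f_def pmf_of_set field_simps)
    then show ?thesis
      using c pmf_le_1[of p z] by simp
  next
    case False
    then have "pmf p z = 0"
      using assms by (auto simp: set_pmf_iff)
    then show ?thesis by (simp add: f_def)
  qed
  have one: "(\<Sum>z\<in>UNIV. pmf r z) = 1" for r :: "'z pmf"
    by (rule sum_pmf_eq_1) auto
  have "sum f UNIV = 1"
    by (simp add: f_def sum.distrib sum_subtractf one flip: sum_divide_distrib)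
  then have "(\<integral>\<^sup>+z. ennreal (f z) \<partial>count_space UNIV) = 1"
    by (simp add: nn_integral_count_space_finite sum_ennreal nn)
  then have "pmf (embed_pmf f) z = f z" for z
    by (intro pmf_embed_pmf nn)
  then show ?thesis
    using that unfolding f_def by blast
qed

text \<open>Moving the uniform lottery on \<open>E\<close> slightly along \<open>q - p\<close> gives a lottery again,
  so the inclusion of contour sets at the uniform lottery transfers to every lottery on \<open>E\<close>.\<close>

lemma LY_uniform_transfer:
  fixes v v' :: "'z::finite \<Rightarrow> real"
  assumes "E \<noteq> {}" "E \<subseteq> S" "set_pmf p \<subseteq> E" "set_pmf q \<subseteq> S"
    and incl: "Delta S \<inter> LY v (pmf_of_set E) \<subseteq> LY v' (pmf_of_set E)"
    and "EU v q \<le> EU v p"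
  shows "EU v' q \<le> EU v' p"
proof -
  obtain y where y: "\<And>z. pmf y z = pmf (pmf_of_set E) z + (pmf q z - pmf p z) / card E"
    using ex_shifted_uniform[OF assms(1,3)] by blast
  have EUy: "EU w y = EU w (pmf_of_set E) + (EU w q - EU w p) / card E" for w
    unfolding EU_def y
    by (simp add: sum.distrib sum_subtractf sum_divide_distrib algebra_simps diff_divide_distrib
        flip: sum_divide_distrib)
  have c: "real (card E) > 0"
    using assms by (simp add: card_gt_0_iff)
  have "set_pmf y \<subseteq> S"
  proof
    fix z assume "z \<in> set_pmf y"
    then have "z \<in> E \<or> z \<in> set_pmf q \<or> z \<in> set_pmf p"
      using assms(1) by (auto simp: set_pmf_iff y)
    then show "z \<in> S" using assms by blast
  qed
  moreover have "EU v y \<le> EU v (pmf_of_set E)"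
    using assms(6) c by (simp add: EUy divide_nonpos_pos)
  ultimately have "EU v' y \<le> EU v' (pmf_of_set E)"
    using incl by (auto simp: Delta_def LY_def)
  then have "(EU v' q - EU v' p) / card E \<le> 0"
    by (simp add: EUy)
  then show ?thesis
    using c assms(1) by (auto simp: divide_le_0_iff)
qed

section \<open>The modified lower contour sets\<close>

abbreviation lower_outcomes ::
  "('i \<Rightarrow> 'th \<Rightarrow> 'z::finite \<Rightarrow> real) \<Rightarrow> ('th \<Rightarrow> 'z set) \<Rightarrow> 'i \<Rightarrow> 'th \<Rightarrow> 'z set" where
  "lower_outcomes u F i th \<equiv> Zstar u F \<inter> LZset (u i th) (F th)"

definition exceptional ::
  "('i \<Rightarrow> 'th \<Rightarrow> 'z::finite \<Rightarrow> real) \<Rightarrow> ('th \<Rightarrow> 'z set) \<Rightarrow> 'i \<Rightarrow> 'th \<Rightarrow> bool" where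
  "exceptional u F i th \<longleftrightarrow> F th \<subseteq> argmin_on (u i th) (Zstar u F) \<and> Xi u F i th \<noteq> {} \<and>
     Lam u F i (lower_outcomes u F i th) \<noteq> {}"

text \<open>Gives both branches of \<open>Lhat\<close> the common form of \<open>Lhat_eq\<close>,
  lotteries on a set of outcomes cut by a contour set, which is the form that \<open>ex_menu\<close>
  requires.\<close>

definition Lsupport ::
  "('i \<Rightarrow> 'th \<Rightarrow> 'z::finite \<Rightarrow> real) \<Rightarrow> ('th \<Rightarrow> 'z set) \<Rightarrow> 'i \<Rightarrow> 'th \<Rightarrow> 'z set" where
  "Lsupport u F i th =
     (if exceptional u F i th
      then lower_outcomes u F i th \<inter> (\<Union>K\<in>Xi u F i th. \<Inter>th'\<in>K. F th')
      else Zstar u F)"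

lemma F_subset_Zstar: "F th \<subseteq> Zstar u F"
  by (auto simp: Zstar_def)

lemma F_subset_lower_outcomes:
  "F th \<subseteq> argmin_on (u i th) (Zstar u F) \<Longrightarrow> F th \<subseteq> lower_outcomes u F i th"
  by (auto simp: argmin_on_def LZset_eq)

lemma F_subset_Lsupport: "F th \<subseteq> Lsupport u F i th"
proof (cases "exceptional u F i th")
  case True
  then obtain K where K: "K \<in> Xi u F i th"
    by (auto simp: exceptional_def)
  have "F th \<subseteq> (\<Inter>th'\<in>K. F th')"
    using K by (auto simp: Xi_def ThetaI_def)
  moreover have "F th \<subseteq> lower_outcomes u F i th"
    using True by (intro F_subset_lower_outcomes) (simp add: exceptional_def)
  ultimately have "F th \<subseteq> lower_outcomes u F i th \<inter> (\<Union>K\<in>Xi u F i th. \<Inter>th'\<in>K. F th')"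
    using K by blast
  then show ?thesis
    using True by (simp add: Lsupport_def)
qed (simp add: Lsupport_def F_subset_Zstar)

lemma Lsupport_subset_Zstar: "Lsupport u F i th \<subseteq> Zstar u F"
  by (auto simp: Lsupport_def)

text \<open>In the exceptional case the contour set cuts nothing off: a member \<open>w\<close> of
  \<open>F th\<close> is at least as good for \<open>i\<close> as every outcome in
  \<open>Lsupport\<close> and, being a minimiser, no better than the uniform lottery.\<close>

lemma Lhat_eq:
  assumes "F th \<noteq> {}"
  shows "Lhat u F i th = Delta (Lsupport u F i th) \<inter> LY (u i th) (pmf_of_set (F th))"
proof (cases "exceptional u F i th")
  case True
  have "Delta (Lsupport u F i th) \<subseteq> LY (u i th) (pmf_of_set (F th))"
  proof
    fix y assume y: "y \<in> Delta (Lsupport u F i th)"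
    obtain w where w: "w \<in> F th" using assms by blast
    have "EU (u i th) y \<le> u i th w"
      using y True w by (intro EU_le) (auto simp: Delta_def Lsupport_def LZset_eq)
    also have "u i th w \<le> EU (u i th) (pmf_of_set (F th))"
      using True w assms by (intro EU_ge) (auto simp: exceptional_def argmin_on_def)
    finally show "y \<in> LY (u i th) (pmf_of_set (F th))" by (simp add: LY_def)
  qed
  moreover have "Lhat u F i th = Delta (Lsupport u F i th)"
    using True by (simp add: Lhat_def Lsupport_def exceptional_def Int_assoc)
  ultimately show ?thesis by blast
qed (auto simp: Lhat_def Lsupport_def exceptional_def)

lemma uniform_in_Lhat: "F th \<noteq> {} \<Longrightarrow> pmf_of_set (F th) \<in> Lhat u F i th"
  using F_subset_Lsupport[of F th u i] by (simp add: Lhat_eq Delta_def LY_def)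

lemma Lhat_subset_Delta_Zstar: "F th \<noteq> {} \<Longrightarrow> Lhat u F i th \<subseteq> Delta (Zstar u F)"
  using Lsupport_subset_Zstar[of u F i th] by (auto simp: Lhat_eq Delta_def)

section \<open>Max sets and the least element of \<open>Xi\<close>\<close>

lemma subset_argmax_on_iff: "E \<subseteq> argmax_on v S \<longleftrightarrow> E \<subseteq> S \<and> (\<forall>x\<in>E. \<forall>y\<in>S. v y \<le> v x)"
  by (auto simp: argmax_on_def)

lemma mem_Lam_iff:
  "th \<in> Lam u F i E \<longleftrightarrow> E \<noteq> {} \<and> E \<subseteq> Zstar u F \<and> (\<forall>x\<in>E. \<forall>y\<in>E. u i th y \<le> u i th x) \<and>
    (\<forall>j. j \<noteq> i \<longrightarrow> (\<forall>x\<in>E. \<forall>y\<in>Zstar u F. u j th y \<le> u j th x))"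
  by (auto simp: Lam_def iZmax_def subset_argmax_on_iff)

lemma Lam_antimono:
  assumes "E \<noteq> {}" "E \<subseteq> E'"
  shows "Lam u F i E' \<subseteq> Lam u F i E"
proof
  fix th assume "th \<in> Lam u F i E'"
  with assms show "th \<in> Lam u F i E"
    unfolding mem_Lam_iff by (meson subset_iff)
qed

text \<open>\<open>\<Xi>\<^sub>i(\<theta>)\<close> consists of the nonempty fixed points of a monotone operator (Knaster--Tarski).\<close>

lemma least_Xi:
  assumes ne: "F th \<noteq> {}" and D: "F th \<subseteq> lower_outcomes u F i th"
    and th1: "th1 \<in> ThetaI u F i th" "th1 \<in> Lam u F i (lower_outcomes u F i th)"
  obtains K0 where "K0 \<in> Xi u F i th"
    and "\<And>K. K \<subseteq> ThetaI u F i th \<Longrightarrow>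
      ThetaI u F i th \<inter> Lam u F i (lower_outcomes u F i th \<inter> (\<Inter>th'\<in>K. F th')) \<subseteq> K \<Longrightarrow> K0 \<subseteq> K"
proof -
  define T where "T = ThetaI u F i th"
  define G where "G K = lower_outcomes u F i th \<inter> (\<Inter>th'\<in>K. F th')" for K
  \<comment> \<open>Cutting \<open>K\<close> down to \<open>T\<close> keeps \<open>F th\<close>
    inside \<open>G (K \<inter> T)\<close> for arbitrary \<open>K\<close>, so this set is never
    empty and \<open>Lam_antimono\<close> makes \<open>P\<close> monotone.\<close>
  define P where "P K = T \<inter> Lam u F i (G (K \<inter> T))" for K
  have G: "F th \<subseteq> G (K \<inter> T)" for K
    using D by (auto simp: G_def T_def ThetaI_def)
  then have ne_G: "G (K \<inter> T) \<noteq> {}" for K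
    using ne by blast
  have "mono P"
  proof (rule monoI)
    fix K K' :: "'b set" assume "K \<subseteq> K'"
    then have "G (K' \<inter> T) \<subseteq> G (K \<inter> T)" by (auto simp: G_def)
    then have "Lam u F i (G (K \<inter> T)) \<subseteq> Lam u F i (G (K' \<inter> T))"
      using ne_G by (intro Lam_antimono)
    then show "P K \<subseteq> P K'" by (auto simp: P_def)
  qed
  then have fix_P: "P (lfp P) = lfp P"
    by (metis lfp_unfold)
  have sub: "lfp P \<subseteq> T"
    using fix_P by (auto simp: P_def)
  \<comment> \<open>This lower bound on every value of \<open>P\<close> puts \<open>th1\<close> into
    the least fixed point, which is therefore nonempty.\<close>
  have base: "T \<inter> Lam u F i (lower_outcomes u F i th) \<subseteq> P K" for K
  proof -
    have "Lam u F i (lower_outcomes u F i th) \<subseteq> Lam u F i (G (K \<inter> T))"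
      using ne_G by (intro Lam_antimono) (auto simp: G_def)
    then show ?thesis by (auto simp: P_def)
  qed
  then have base': "T \<inter> Lam u F i (lower_outcomes u F i th) \<subseteq> lfp P"
    using fix_P by metis
  have "lfp P \<inter> T = lfp P" using sub by blast
  then have "T \<inter> Lam u F i (G (lfp P)) = lfp P"
    using fix_P by (simp add: P_def)
  moreover have "lfp P \<noteq> {}"
    using base' th1 by (auto simp: T_def)
  ultimately have "lfp P \<in> Xi u F i th"
    using sub by (simp add: Xi_def G_def T_def)
  moreover have "lfp P \<subseteq> K" if "K \<subseteq> T" "T \<inter> Lam u F i (G K) \<subseteq> K" for K
    using that by (intro lfp_lowerbound) (auto simp: P_def Int_absorb2)
  ultimately show ?thesis
    using that unfolding T_def G_def by blast
qed

section \<open>Necessity of uniform monotonicity\<close>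

text \<open>If the set of all outcomes is a max set at some state, everybody is indifferent there,
  so every feasible profile is an equilibrium and its outcomes belong to a value of
  \<open>F\<close>. Otherwise Z* is everything.\<close>

lemma implemented_outcomes_in_Zstar:
  fixes u :: "'i::finite \<Rightarrow> 'th \<Rightarrow> 'z::finite \<Rightarrow> real"
  assumes imp: "\<And>th. (\<Union>lam\<in>MNE M g u th. set_pmf (induced g lam)) = F th"
    and feas: "\<And>i. set_pmf (lam i) \<subseteq> M i"
  shows "set_pmf (induced g lam) \<subseteq> Zstar u F"
proof (cases "\<exists>i. imax_set u i UNIV")
  case True
  then obtain i th where
    "UNIV \<subseteq> argmax_on (u i th) UNIV" "\<And>j. j \<noteq> i \<Longrightarrow> UNIV \<subseteq> argmax_on (u j th) UNIV"
    by (auto simp: imax_set_def)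
  then have "UNIV \<subseteq> argmax_on (u j th) UNIV" for j
    by (cases "j = i") auto
  then have "u j th z = u j th z'" for j z z'
    by (auto simp: argmax_on_def intro: antisym)
  then have "EU (u j th) p = EU (u j th) q" for j p q
    by (metis EU_const)
  then have "lam \<in> MNE M g u th"
    using feas unfolding MNE_def by (simp add: order_eq_refl)
  then have "set_pmf (induced g lam) \<subseteq> F th"
    using imp[of th] by blast
  then show ?thesis
    using F_subset_Zstar[of F th u] by blast
qed (simp add: Zstar_def)

lemma deviation_outcomes:
  fixes u :: "'i::finite \<Rightarrow> 'th \<Rightarrow> 'z::finite \<Rightarrow> real"
  assumes imp: "\<And>th. (\<Union>lam\<in>MNE M g u th. set_pmf (induced g lam)) = F th"
    and lam: "lam \<in> MNE M g u th"
    and bad: "F th \<subseteq> argmin_on (u i th) (Zstar u F)"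
  defines "C \<equiv> \<Union>mu\<in>{mu. set_pmf mu \<subseteq> M i}. set_pmf (induced g (lam(i := mu)))"
  shows "set_pmf (induced g lam) \<subseteq> C" and "C \<noteq> {}"
    and "C \<subseteq> lower_outcomes u F i th"
    and "th' \<in> Lam u F i C \<Longrightarrow> C \<subseteq> F th'"
proof -
  have feas: "set_pmf (lam j) \<subseteq> M j" for j
    using lam by (auto simp: MNE_def)
  have "set_pmf (induced g (lam(i := lam i))) \<subseteq> C"
    unfolding C_def using feas by blast
  then show sub: "set_pmf (induced g lam) \<subseteq> C" by simp
  then show "C \<noteq> {}" using set_pmf_not_empty by fastforce
  have inS: "set_pmf (induced g (lam(i := mu))) \<subseteq> Zstar u F" if "set_pmf mu \<subseteq> M i" for mu
    using imp by (rule implemented_outcomes_in_Zstar) (use that feas in auto)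
  show "C \<subseteq> lower_outcomes u F i th"
  proof
    fix z assume "z \<in> C"
    then obtain mu where mu: "set_pmf mu \<subseteq> M i" "z \<in> set_pmf (induced g (lam(i := mu)))"
      by (auto simp: C_def)
    have "u i th z \<le> u i th w" if w: "w \<in> F th" for w
    proof -
      have "EU (u i th) (induced g (lam(i := mu))) \<le> EU (u i th) (induced g lam)"
        using lam mu by (auto simp: MNE_def)
      also have "EU (u i th) (induced g lam) \<le> u i th w"
      proof (rule EU_le)
        fix x assume "x \<in> set_pmf (induced g lam)"
        then have "x \<in> F th" using imp[of th] lam by blast
        then show "u i th x \<le> u i th w"
          using bad w by (auto simp: argmin_on_def)
      qed
      finally have "EU (u i th) (induced g (lam(i := mu))) \<le> u i th w" .
      \<comment> \<open>A lottery on Z* worth at most the minimum over Z* puts all its weight on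
        minimisers.\<close>
      then have "u i th z = u i th w"
        using bad w inS[OF mu(1)] mu(2)
        by (intro EU_min_imp_const[where p="induced g (lam(i := mu))"]) (auto simp: argmin_on_def)
      then show ?thesis by simp
    qed
    then show "z \<in> lower_outcomes u F i th"
      using inS[OF mu(1)] mu(2) by (auto simp: LZset_eq)
  qed
  show "C \<subseteq> F th'" if th': "th' \<in> Lam u F i C"
  proof
    fix z assume "z \<in> C"
    then obtain mu where mu: "set_pmf mu \<subseteq> M i" "z \<in> set_pmf (induced g (lam(i := mu)))"
      by (auto simp: C_def)
    have max_i: "u i th' x = u i th' y" if "x \<in> C" "y \<in> C" for x y
      using th' that unfolding mem_Lam_iff by (meson antisym)
    have max_j: "u j th' y \<le> u j th' x" if "j \<noteq> i" "x \<in> C" "y \<in> Zstar u F" for j x y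
      using th' that unfolding mem_Lam_iff by blast
    have inC: "set_pmf (induced g (lam(i := nu))) \<subseteq> C" if "set_pmf nu \<subseteq> M i" for nu
      using that by (auto simp: C_def)
    \<comment> \<open>At \<open>th'\<close> agent \<open>i\<close> is indifferent on
      \<open>C\<close> and cannot leave it, while the outcomes in \<open>C\<close> are best in Z*
      for everyone else; so nobody gains by deviating.\<close>
    have "lam(i := mu) \<in> MNE M g u th'"
      unfolding MNE_def
    proof (intro CollectI conjI allI impI)
      show "set_pmf ((lam(i := mu)) j) \<subseteq> M j" for j
        using feas mu by simp
      fix j nu assume nu: "set_pmf nu \<subseteq> M j"
      show "EU (u j th') (induced g ((lam(i := mu))(j := nu)))
        \<le> EU (u j th') (induced g (lam(i := mu)))"
      proof (cases "j = i")
        case True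
        have "EU (u i th') (induced g (lam(i := nu'))) = u i th' z" if "set_pmf nu' \<subseteq> M i" for nu'
          using inC[OF that] \<open>z \<in> C\<close> max_i by (intro EU_const) blast
        then show ?thesis using True mu nu by simp
      next
        case False
        have S: "set_pmf (induced g ((lam(i := mu))(j := nu))) \<subseteq> Zstar u F"
          using imp by (rule implemented_outcomes_in_Zstar) (use mu nu feas in auto)
        have "EU (u j th') (induced g ((lam(i := mu))(j := nu))) \<le> u j th' z"
          using S max_j[OF False \<open>z \<in> C\<close>] by (intro EU_le) blast
        also have "u j th' z \<le> EU (u j th') (induced g (lam(i := mu)))"
          using inC[OF mu(1)] max_j[OF False] inS[OF mu(1)] mu(2) by (intro EU_ge) blast
        finally show ?thesis .
      qed
    qed
    then show "z \<in> F th'" using imp[of th'] mu by blast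
  qed
qed

lemma mixedA_impl_imp_unif_mono:
  fixes u :: "'i::finite \<Rightarrow> 'th \<Rightarrow> 'z::finite \<Rightarrow> real"
  assumes ne: "\<And>th. F th \<noteq> {}" and "mixedA_impl u F"
  shows "unif_mono u F"
proof -
  obtain M :: "'i \<Rightarrow> nat set" and g
    where imp: "\<And>th. (\<Union>lam\<in>MNE M g u th. set_pmf (induced g lam)) = F th"
    using assms unfolding mixedA_impl_def by metis
  show ?thesis
    unfolding unif_mono_def
  proof (intro allI impI)
    fix th th' assume incl: "\<forall>i. Lhat u F i th \<subseteq> LY (u i th') (pmf_of_set (F th))"
    have "lam \<in> MNE M g u th'" if lam: "lam \<in> MNE M g u th" for lam
      unfolding MNE_def
    proof (intro CollectI conjI allI impI)
      show feas: "set_pmf (lam i) \<subseteq> M i" for i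
        using lam by (auto simp: MNE_def)
      fix i mu assume mu: "set_pmf mu \<subseteq> M i"
      define p where "p = induced g lam"
      define q where "q = induced g (lam(i := mu))"
      have pF: "set_pmf p \<subseteq> F th"
        using imp[of th] lam by (auto simp: p_def)
      have qS: "set_pmf q \<subseteq> Zstar u F"
        unfolding q_def using imp by (rule implemented_outcomes_in_Zstar) (use mu feas in auto)
      have le: "EU (u i th) q \<le> EU (u i th) p"
        using lam mu by (auto simp: MNE_def p_def q_def)
      have "EU (u i th') q \<le> EU (u i th') p"
      proof (cases "exceptional u F i th")
        case False
        \<comment> \<open>The hypothesis compares with the uniform lottery only;
          \<open>LY_uniform_transfer\<close> carries it over to the actual equilibrium lottery
          \<open>p\<close> and deviation \<open>q\<close>.\<close>
        then have "Delta (Zstar u F) \<inter> LY (u i th) (pmf_of_set (F th)) \<subseteq> LY (u i th') (pmf_of_set (F th))"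
          using incl[rule_format, of i] by (simp add: Lhat_eq ne Lsupport_def)
        then show ?thesis
          using LY_uniform_transfer[OF ne F_subset_Zstar pF qS _ le] by blast
      next
        case True
        then have bad: "F th \<subseteq> argmin_on (u i th) (Zstar u F)"
          by (simp add: exceptional_def)
        define D where "D = lower_outcomes u F i th"
        define C where "C = (\<Union>mu\<in>{mu. set_pmf mu \<subseteq> M i}. set_pmf (induced g (lam(i := mu))))"
        note dev = deviation_outcomes[where i=i and M=M and g=g and u=u and F=F and th=th, OF imp _ bad]
        have C: "C \<noteq> {}" "C \<subseteq> D" "\<And>t. t \<in> Lam u F i C \<Longrightarrow> C \<subseteq> F t"
          using dev(2,3,4)[OF lam] by (simp_all add: C_def D_def)
        have FD: "F th \<subseteq> D"
          using F_subset_lower_outcomes[OF bad] by (simp add: D_def)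
        obtain th1 where th1: "th1 \<in> Lam u F i D"
          using True by (auto simp: exceptional_def D_def)
        \<comment> \<open>Every equilibrium \<open>l\<close> at \<open>th\<close> has its own set of
          reachable outcomes inside \<open>D\<close>, so \<open>th1\<close> makes each of these a
          max set and hence a subset of \<open>F th1\<close>.\<close>
        have "F th \<subseteq> F th1"
        proof
          fix z assume "z \<in> F th"
          then obtain l where l: "l \<in> MNE M g u th" "z \<in> set_pmf (induced g l)"
            using imp[of th] by blast
          have "th1 \<in> Lam u F i (\<Union>mu\<in>{mu. set_pmf mu \<subseteq> M i}. set_pmf (induced g (l(i := mu))))"
            using th1 Lam_antimono[OF dev(2,3)[OF l(1)], of u F i] by (auto simp: D_def)
          then show "z \<in> F th1"
            using dev(1,4)[OF l(1)] l(2) by blast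
        qed
        moreover have "th1 \<in> Lam u F i (F th)"
          using th1 Lam_antimono[OF ne FD, of u F i] by blast
        ultimately have th1T: "th1 \<in> ThetaI u F i th"
          by (simp add: ThetaI_def Lam_def)
        obtain K0 where K0: "K0 \<in> Xi u F i th" and
          least: "\<And>K. K \<subseteq> ThetaI u F i th \<Longrightarrow>
            ThetaI u F i th \<inter> Lam u F i (D \<inter> (\<Inter>th'\<in>K. F th')) \<subseteq> K \<Longrightarrow> K0 \<subseteq> K"
          using least_Xi[OF ne FD[unfolded D_def] th1T th1[unfolded D_def]] unfolding D_def by metis
        \<comment> \<open>A pre-fixed point: \<open>C\<close> lies in \<open>D\<close> and in
          \<open>F t\<close> for all \<open>t\<close> in \<open>K\<close>, so a state that makes
          this larger intersection a max set also makes \<open>C\<close> one.\<close>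
        define K where "K = ThetaI u F i th \<inter> Lam u F i C"
        have CK: "C \<subseteq> D \<inter> (\<Inter>th'\<in>K. F th')"
          using C by (auto simp: K_def)
        have "K0 \<subseteq> K"
          using Lam_antimono[OF C(1) CK, of u F i] by (intro least) (auto simp: K_def)
        then have "C \<subseteq> (\<Inter>th'\<in>K0. F th')"
          using CK by blast
        then have "C \<subseteq> D \<inter> (\<Union>K\<in>Xi u F i th. \<Inter>th'\<in>K. F th')"
          using C(2) K0 by blast
        then have "C \<subseteq> Lsupport u F i th"
          using True by (simp add: Lsupport_def D_def)
        moreover have "set_pmf q \<subseteq> C"
          using mu by (auto simp: q_def C_def)
        ultimately have qsub: "set_pmf q \<subseteq> Lsupport u F i th" by blast
        define c where "c = EU (u i th') (pmf_of_set (F th))"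
        have Lh: "Lhat u F i th = Delta (Lsupport u F i th)"
          using True by (simp add: Lhat_def Lsupport_def exceptional_def Int_assoc)
        have Lle: "EU (u i th') y \<le> c" if "set_pmf y \<subseteq> Lsupport u F i th" for y
        proof -
          have "y \<in> Lhat u F i th" using that by (simp add: Lh Delta_def)
          then have "y \<in> LY (u i th') (pmf_of_set (F th))" using incl by blast
          then show ?thesis by (simp add: LY_def c_def)
        qed
        \<comment> \<open>Point masses on \<open>F th\<close> belong to \<open>Lhat\<close>, so no
          outcome in \<open>F th\<close> exceeds the average \<open>c\<close>; hence all of them
          equal \<open>c\<close>.\<close>
        have zle: "u i th' z \<le> c" if "z \<in> F th" for z
          using Lle[of "return_pmf z"] F_subset_Lsupport[of F th u i] that by auto
        have "u i th' z = c" if "z \<in> F th" for z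
          using zle that ne by (intro EU_max_imp_const[of "pmf_of_set (F th)"]) (auto simp: c_def)
        then have "EU (u i th') p = c"
          using pF by (intro EU_const) blast
        then show ?thesis using Lle[OF qsub] by simp
      qed
      then show "EU (u i th') (induced g (lam(i := mu))) \<le> EU (u i th') (induced g lam)"
        by (simp add: p_def q_def)
    qed
    then show "F th \<subseteq> F th'"
      using imp[of th] imp[of th'] by blast
  qed
qed

section \<open>Menus\<close>

text \<open>The zero utility presents an unrestricted menu as a contour set, so that
  \<open>ex_menu\<close> applies to it.\<close>

lemma Delta_eq_contour: "Delta S = Delta S \<inter> LY (\<lambda>_. 0) q"
  by (simp add: LY_def)

lemma return_in_Delta: "z \<in> S \<Longrightarrow> return_pmf z \<in> Delta S"
  by (simp add: Delta_def)

lemma bind_in_contour: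
  assumes "\<And>x. x \<in> set_pmf P \<Longrightarrow> g x \<in> Delta A \<inter> LY v q"
  shows "bind_pmf P g \<in> Delta A \<inter> LY v q"
proof -
  have "set_pmf (g x) \<subseteq> A" "EU v (g x) \<le> EU v q" if "x \<in> set_pmf P" for x
    using assms[OF that] by (simp_all add: Delta_def LY_def)
  then have "set_pmf (bind_pmf P g) \<subseteq> A" "EU v (bind_pmf P g) \<le> EU v q"
    by (auto intro: EU_bind_le)
  then show ?thesis by (simp add: Delta_def LY_def)
qed

lemma bdd_above_EU: "bdd_above (EU v ` X)"
  by (rule bdd_aboveI2[OF abs_le_D1[OF EU_abs_le]])

lemma EU_le_Sup: "y \<in> X \<Longrightarrow> EU v y \<le> Sup (EU v ` X)"
  by (rule cSUP_upper[OF _ bdd_above_EU])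

text \<open>A mixture of countably many lotteries, with all weights positive, that includes a
  non-maximal one for every utility under which some lottery in \<open>X\<close> is not maximal.\<close>

lemma ex_core:
  fixes w :: "'th::countable \<Rightarrow> 'z::finite \<Rightarrow> real"
  assumes X: "X = Delta A \<inter> LY v q" and y0: "y0 \<in> X"
  obtains r where "r \<in> X" "\<And>y. y \<in> X \<Longrightarrow> set_pmf y \<subseteq> set_pmf r"
    "\<And>t y. (\<And>y. y \<in> X \<Longrightarrow> EU (w t) y \<le> EU (w t) r) \<Longrightarrow> y \<in> X \<Longrightarrow> EU (w t) y = EU (w t) r"
proof -
  \<comment> \<open>\<open>low t\<close> is non-maximal under \<open>w t\<close> whenever
    \<open>X\<close> offers two different utility levels; \<open>cov z\<close> has \<open>z\<close>
    in its support whenever some lottery in \<open>X\<close> does.\<close>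
  have "\<exists>y\<in>X. (\<exists>x\<in>X. \<exists>x'\<in>X. EU (w t) x < EU (w t) x') \<longrightarrow> (\<exists>y'\<in>X. EU (w t) y < EU (w t) y')" for t
    using y0 by blast
  then obtain low where low: "\<And>t. low t \<in> X"
    "\<And>t x x'. x \<in> X \<Longrightarrow> x' \<in> X \<Longrightarrow> EU (w t) x < EU (w t) x' \<Longrightarrow> \<exists>y'\<in>X. EU (w t) (low t) < EU (w t) y'"
    by metis
  have "\<exists>y\<in>X. (\<exists>x\<in>X. z \<in> set_pmf x) \<longrightarrow> z \<in> set_pmf y" for z
    using y0 by blast
  then obtain cov where cov: "\<And>z. cov z \<in> X" "\<And>z x. x \<in> X \<Longrightarrow> z \<in> set_pmf x \<Longrightarrow> z \<in> set_pmf (cov z)"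
    by metis
  define f where "f = case_sum low cov"
  have f: "f s \<in> X" for s
    using low(1) cov(1) by (cases s) (auto simp: f_def)
  \<comment> \<open>The index type is countable, so the image of a geometric distribution under
    \<open>from_nat\<close> has full support.\<close>
  define W :: "('th + 'z) pmf" where "W = map_pmf from_nat (geometric_pmf (1/2))"
  have W: "set_pmf W = UNIV"
    by (simp add: W_def set_pmf_geometric)
  define r where "r = bind_pmf W f"
  show ?thesis
  proof (rule that)
    show "r \<in> X"
      unfolding r_def X by (rule bind_in_contour) (use f X in auto)
    show "set_pmf y \<subseteq> set_pmf r" if y: "y \<in> X" for y
    proof
      fix z assume "z \<in> set_pmf y"
      then have "z \<in> set_pmf (f (Inr z))"
        using cov(2) y by (simp add: f_def)
      then show "z \<in> set_pmf r"
        unfolding r_def by (simp only: set_bind_pmf W) blast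
    qed
    show "EU (w t) y = EU (w t) r" if le: "\<And>y. y \<in> X \<Longrightarrow> EU (w t) y \<le> EU (w t) r" and y: "y \<in> X" for t y
    proof (rule ccontr)
      assume "EU (w t) y \<noteq> EU (w t) r"
      then have "EU (w t) y < EU (w t) r" using le[OF y] by simp
      then obtain y' where y': "y' \<in> X" "EU (w t) (low t) < EU (w t) y'"
        using low(2)[OF y \<open>r \<in> X\<close>] by blast
      \<comment> \<open>A mixture attains the maximum only if each of its components does, including
        \<open>low t\<close>.\<close>
      have "EU (w t) (f (Inl t)) = EU (w t) r"
        using le f W by (intro EU_bind_max_imp_const[of W]) (auto simp: r_def)
      then show False
        using y' le[OF y'(1)] by (simp add: f_def)
    qed
  qed
qed

text \<open>\<open>c t k\<close> is the lottery from \<open>X\<close> received by an agent who reports utility \<open>w t\<close> and the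
  integer \<open>k\<close>: higher integers come closer to the optimum without attaining it, except when the
  agent is indifferent on all of \<open>X\<close>.\<close>

definition menu ::
  "('th \<Rightarrow> 'z::finite \<Rightarrow> real) \<Rightarrow> 'z pmf set \<Rightarrow> ('th \<Rightarrow> nat \<Rightarrow> 'z pmf) \<Rightarrow> bool" where
  "menu w X c \<longleftrightarrow>
     (\<forall>t k. c t k \<in> X) \<and>
     (\<forall>t k. \<forall>y\<in>X. set_pmf y \<subseteq> set_pmf (c t k)) \<and>
     (\<forall>t. (\<lambda>k. EU (w t) (c t k)) \<longlonglongrightarrow> Sup (EU (w t) ` X)) \<and>
     (\<forall>s t k. EU (w s) (c t k) = Sup (EU (w s) ` X) \<longrightarrow> (\<forall>y\<in>X. EU (w s) y = Sup (EU (w s) ` X)))"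

lemma menu_mem: "menu w X c \<Longrightarrow> c t k \<in> X"
  unfolding menu_def by blast

lemma menu_support: "menu w X c \<Longrightarrow> y \<in> X \<Longrightarrow> set_pmf y \<subseteq> set_pmf (c t k)"
  unfolding menu_def by blast

lemma menu_tendsto: "menu w X c \<Longrightarrow> (\<lambda>k. EU (w t) (c t k)) \<longlonglongrightarrow> Sup (EU (w t) ` X)"
  unfolding menu_def by blast

lemma menu_indifferent:
  "menu w X c \<Longrightarrow> EU (w s) (c t k) = Sup (EU (w s) ` X) \<Longrightarrow> y \<in> X \<Longrightarrow> EU (w s) y = Sup (EU (w s) ` X)"
  unfolding menu_def by blast

lemma ex_menu:
  fixes w :: "'th::countable \<Rightarrow> 'z::finite \<Rightarrow> real"
  assumes X: "X = Delta A \<inter> LY v q" and "X \<noteq> {}"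
  shows "\<exists>c. menu w X c"
proof -
  obtain y0 where "y0 \<in> X" using assms by blast
  then obtain r where r: "r \<in> X" "\<And>y. y \<in> X \<Longrightarrow> set_pmf y \<subseteq> set_pmf r"
    "\<And>t y. (\<And>y. y \<in> X \<Longrightarrow> EU (w t) y \<le> EU (w t) r) \<Longrightarrow> y \<in> X \<Longrightarrow> EU (w t) y = EU (w t) r"
    using ex_core[OF X, of y0 w] by metis
  \<comment> \<open>Used twice: as the error allowed to the near-optimal choice \<open>b t k\<close>
    and as the weight of \<open>r\<close>. It tends to 0 but stays positive, so \<open>r\<close> is
    never absent.\<close>
  define e where "e k = inverse (real (Suc k))" for k
  have e: "0 < e k" "e k \<le> 1" for k
    by (simp_all add: e_def inverse_le_1_iff)
  have e0: "e \<longlonglongrightarrow> 0"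
    unfolding e_def by (rule LIMSEQ_inverse_real_of_nat)
  have "\<exists>y\<in>X. Sup (EU (w t) ` X) - e k < EU (w t) y" for t k
  proof -
    have "Sup (EU (w t) ` X) - e k < Sup (EU (w t) ` X)" using e by simp
    then show ?thesis
      using less_cSUP_iff[OF \<open>X \<noteq> {}\<close> bdd_above_EU] by blast
  qed
  then obtain b where b: "\<And>t k. b t k \<in> X" "\<And>t k. Sup (EU (w t) ` X) - e k < EU (w t) (b t k)"
    by metis
  define c where "c t k = bind_pmf (bernoulli_pmf (e k)) (\<lambda>x. if x then r else b t k)" for t k
  have True_e: "True \<in> set_pmf (bernoulli_pmf (e k))" for k
    using e[of k] by (simp add: set_pmf_iff)
  have cX: "c t k \<in> X" for t k
  proof -
    have "(if x then r else b t k) \<in> X" for x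
      using r(1) b(1) by simp
    then show ?thesis
      unfolding c_def X by (rule bind_in_contour)
  qed
  have cov: "set_pmf y \<subseteq> set_pmf (c t k)" if "y \<in> X" for y t k
  proof -
    have "set_pmf r \<subseteq> set_pmf (c t k)"
      unfolding c_def set_bind_pmf
      using UN_upper[OF True_e, of "\<lambda>x. set_pmf (if x then r else b t k)" k] by simp
    then show ?thesis using r(2)[OF that] by blast
  qed
  have lim: "(\<lambda>k. EU (w t) (c t k)) \<longlonglongrightarrow> Sup (EU (w t) ` X)" for t
  proof -
    let ?M = "Sup (EU (w t) ` X)"
    have lim_b: "(\<lambda>k. EU (w t) (b t k)) \<longlonglongrightarrow> ?M"
    proof (rule tendsto_sandwich)
      show "\<forall>\<^sub>F k in sequentially. ?M - e k \<le> EU (w t) (b t k)"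
        using b(2) by (simp add: less_imp_le)
      show "\<forall>\<^sub>F k in sequentially. EU (w t) (b t k) \<le> ?M"
        using b(1) EU_le_Sup by (intro always_eventually) blast
      show "(\<lambda>k. ?M - e k) \<longlonglongrightarrow> ?M"
        using tendsto_diff[OF tendsto_const e0, of ?M] by simp
    qed simp
    have "EU (w t) (c t k) = EU (w t) r * e k + EU (w t) (b t k) * (1 - e k)" for k
      using e[of k] by (simp add: c_def EU_bind less_imp_le)
    moreover have "(\<lambda>k. EU (w t) r * e k + EU (w t) (b t k) * (1 - e k)) \<longlonglongrightarrow>
        EU (w t) r * 0 + ?M * (1 - 0)"
      by (intro tendsto_intros e0 lim_b)
    ultimately show ?thesis by simp
  qed
  have opt_imp: "\<forall>y\<in>X. EU (w s) y = Sup (EU (w s) ` X)"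
    if opt: "EU (w s) (c t k) = Sup (EU (w s) ` X)" for s t k
  proof -
    have "EU (w s) (if x then r else b t k) \<le> Sup (EU (w s) ` X)" for x
      using r(1) b(1) by (intro EU_le_Sup) simp
    then have "EU (w s) (if True then r else b t k) = Sup (EU (w s) ` X)"
      by (rule EU_bind_max_imp_const[OF _ eq_refl[OF opt[unfolded c_def, symmetric]] True_e])
    then have "EU (w s) r = Sup (EU (w s) ` X)" by simp
    then show ?thesis
      using r(3) EU_le_Sup by metis
  qed
  have "menu w X c"
    unfolding menu_def
  proof (intro conjI allI ballI impI)
    show "c t k \<in> X" for t k by (rule cX)
    show "set_pmf y \<subseteq> set_pmf (c t k)" if "y \<in> X" for t k y
      using that by (rule cov)
    show "(\<lambda>k. EU (w t) (c t k)) \<longlonglongrightarrow> Sup (EU (w t) ` X)" for t by (rule lim)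
    show "EU (w s) y = Sup (EU (w s) ` X)"
      if "EU (w s) (c t k) = Sup (EU (w s) ` X)" "y \<in> X" for s t k y
      using opt_imp[OF that(1)] that(2) by (rule bspec)
  qed
  then show ?thesis by blast
qed

lemma Delta_optimal:
  assumes "EU v p = Sup (EU v ` Delta S)" "set_pmf p \<subseteq> S" "z \<in> set_pmf p" "z' \<in> S"
  shows "v z' \<le> v z"
proof -
  have le: "v x \<le> Sup (EU v ` Delta S)" if "x \<in> S" for x
    using EU_le_Sup[OF return_in_Delta[OF that], of v] by simp
  then have "v z = Sup (EU v ` Delta S)"
    using assms by (intro EU_max_imp_const[of p]) auto
  then show ?thesis using le assms by simp
qed

text \<open>Turns a pure deviation from independent mixing into a change of the drawn profile, so
  that the equilibrium analysis can work with one distribution of profiles.\<close>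

lemma Pi_pmf_upd_return:
  "Pi_pmf (UNIV :: 'i::finite set) d (lam(i := return_pmf x)) =
   map_pmf (\<lambda>m. m(i := x)) (Pi_pmf UNIV d lam)"
proof -
  have U: "(UNIV :: 'i set) = insert i (UNIV - {i})" by blast
  have "Pi_pmf (UNIV - {i}) d (lam(i := return_pmf x)) = Pi_pmf (UNIV - {i}) d lam"
    by (intro Pi_pmf_cong) auto
  then have "Pi_pmf (UNIV :: 'i set) d (lam(i := return_pmf x)) =
      map_pmf (\<lambda>f. f(i := x)) (Pi_pmf (UNIV - {i}) d lam)"
    by (subst U, subst Pi_pmf_insert) (auto simp: pair_return_pmf1 map_pmf_comp)
  also have "\<dots> = map_pmf (\<lambda>f. f(i := x)) (map_pmf snd (pair_pmf (lam i) (Pi_pmf (UNIV - {i}) d lam)))"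
    by (simp add: map_snd_pair_pmf)
  also have "\<dots> = map_pmf (\<lambda>m. m(i := x)) (Pi_pmf UNIV d lam)"
    by (subst (2) U, subst Pi_pmf_insert) (auto simp: map_pmf_comp case_prod_beta)
  finally show ?thesis .
qed

section \<open>The canonical mechanism\<close>

text \<open>A ballot \<open>(\<theta>, k, t)\<close> with \<open>k = 0\<close> endorses the state \<open>\<theta>\<close>; the last two components
  are the integer and the state that a dissenting agent uses to choose from a menu.\<close>

type_synonym 'th ballot = "'th \<times> nat \<times> 'th"

definition assents :: "'th \<Rightarrow> 'th ballot \<Rightarrow> bool" where
  "assents th b \<longleftrightarrow> fst b = th \<and> fst (snd b) = 0"

definition level :: "'th ballot \<Rightarrow> nat" where
  "level b = fst (snd b)"

definition claim :: "'th ballot \<Rightarrow> 'th" where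
  "claim b = snd (snd b)"

definition others_agree :: "('i \<Rightarrow> 'th ballot) \<Rightarrow> 'i \<Rightarrow> 'th \<Rightarrow> bool" where
  "others_agree q i th \<longleftrightarrow> (\<forall>j. j \<noteq> i \<longrightarrow> assents th (q j))"

text \<open>In \<open>c i th t k\<close> the state \<open>th\<close> is the consensus of the others,
  while \<open>t\<close> and \<open>k\<close> are the claim and level of the dissenter
  \<open>i\<close>; \<open>d i t k\<close> serves the winner of a contest.\<close>

locale canonical_mechanism =
  fixes u :: "'i::finite \<Rightarrow> 'th::countable \<Rightarrow> 'z::finite \<Rightarrow> real"
    and F :: "'th \<Rightarrow> 'z set"
    and c :: "'i \<Rightarrow> 'th \<Rightarrow> 'th \<Rightarrow> nat \<Rightarrow> 'z pmf"
    and d :: "'i \<Rightarrow> 'th \<Rightarrow> nat \<Rightarrow> 'z pmf"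
  assumes three: "CARD('i) \<ge> 3"
    and nonempty: "F th \<noteq> {}"
    and mono: "unif_mono u F"
    and menu_c: "menu (u i) (Lhat u F i th) (c i th)"
    and menu_d: "menu (u i) (Delta (Zstar u F)) (d i)"
begin

text \<open>In the first two cases the \<open>SOME\<close> choices are unique, as shown below; in
  the last one ties for the highest level are broken arbitrarily.\<close>

definition outcome :: "('i \<Rightarrow> 'th ballot) \<Rightarrow> 'z pmf" where
  "outcome q =
    (if \<exists>th. \<forall>i. assents th (q i) then pmf_of_set (F (SOME th. \<forall>i. assents th (q i)))
     else if \<exists>i th. others_agree q i th then
       (let i = SOME i. \<exists>th. others_agree q i th; th = SOME th. others_agree q i th
        in c i th (claim (q i)) (level (q i)))
     else (let i = SOME i. \<forall>j. level (q j) \<le> level (q i) in d i (claim (q i)) (level (q i))))"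

text \<open>Determined by the ballots of the agents other than \<open>i\<close>; its supremum is
  what \<open>i\<close> can approach against them.\<close>

definition available :: "'i \<Rightarrow> ('i \<Rightarrow> 'th ballot) \<Rightarrow> 'z pmf set" where
  "available i q =
    (if \<exists>th. others_agree q i th then Lhat u F i (SOME th. others_agree q i th)
     else Delta (Zstar u F))"

section \<open>The three cases of the outcome rule\<close>

lemma third_agent:
  fixes i j :: 'i
  obtains l where "l \<noteq> i" "l \<noteq> j"
proof -
  have "card {i, j} \<le> 2" by (simp add: card_insert_if)
  then have "{i, j} \<noteq> UNIV" using three by auto
  then show ?thesis using that by blast
qed

lemma assents_unique: "assents th b \<Longrightarrow> assents th' b \<Longrightarrow> th = th'"
  by (simp add: assents_def)

text \<open>Having at least three agents matters here: some agent belongs to both agreeing groups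
  and endorses only one state.\<close>

lemma others_agree_same_state:
  fixes q :: "'i \<Rightarrow> 'th ballot"
  assumes "others_agree q i th" "others_agree q j th'"
  shows "th = th'"
proof -
  obtain l where "l \<noteq> i" "l \<noteq> j" by (rule third_agent)
  then have "assents th (q l)" "assents th' (q l)"
    using assms by (simp_all add: others_agree_def)
  then show ?thesis by (rule assents_unique)
qed

lemma others_agree_unique_dissenter:
  fixes q :: "'i \<Rightarrow> 'th ballot"
  assumes "others_agree q i th" "\<not> assents th (q i)" "others_agree q j th'"
  shows "j = i"
proof (rule ccontr)
  assume "j \<noteq> i"
  then have "assents th' (q i)"
    using assms(3) by (simp add: others_agree_def)
  then show False
    using assms(2) others_agree_same_state[OF assms(1,3)] by simp
qed

lemma outcome_consensus:
  assumes "\<And>i. assents th (q i)"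
  shows "outcome q = pmf_of_set (F th)"
proof -
  have eq: "(SOME th'. \<forall>i. assents th' (q i)) = th"
  proof (rule some_equality)
    show "\<forall>i. assents th (q i)" using assms by blast
    show "th' = th" if "\<forall>i. assents th' (q i)" for th'
      using that assms by (simp add: assents_def)
  qed
  have ex: "\<exists>th. \<forall>i. assents th (q i)" using assms by blast
  show ?thesis unfolding outcome_def if_P[OF ex] eq ..
qed

lemma outcome_dissent:
  assumes "others_agree q i th" "\<not> assents th (q i)"
  shows "outcome q = c i th (claim (q i)) (level (q i))"
proof -
  have "(SOME i. \<exists>th. others_agree q i th) = i"
    using assms others_agree_unique_dissenter by (intro some_equality) blast+
  moreover have "(SOME th. others_agree q i th) = th"
    using assms others_agree_same_state by (intro some_equality) blast+
  moreover have "\<nexists>th. \<forall>i. assents th (q i)"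
    using assms others_agree_same_state[of q i th i] unfolding others_agree_def by blast
  ultimately show ?thesis using assms by (auto simp: outcome_def Let_def)
qed

lemma outcome_contest:
  assumes "\<And>i th. \<not> others_agree q i th"
  obtains i where "\<And>j. level (q j) \<le> level (q i)" "outcome q = d i (claim (q i)) (level (q i))"
proof -
  define i where "i = (SOME i. \<forall>j. level (q j) \<le> level (q i))"
  have "\<exists>i. \<forall>j. level (q j) \<le> level (q i)"
  proof -
    have "Max (range (\<lambda>j. level (q j))) \<in> range (\<lambda>j. level (q j))" by (intro Max_in) auto
    then obtain i where "Max (range (\<lambda>j. level (q j))) = level (q i)" by blast
    then show ?thesis by (metis Max_ge finite finite_imageI rangeI)
  qed
  then have "\<forall>j. level (q j) \<le> level (q i)"
    unfolding i_def by (rule someI_ex)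
  moreover have "\<nexists>th. \<forall>i. assents th (q i)"
    using assms unfolding others_agree_def by blast
  then have "outcome q = d i (claim (q i)) (level (q i))"
    using assms by (auto simp: outcome_def i_def Let_def)
  ultimately show ?thesis using that by blast
qed

lemma menu_agree: "others_agree q i th \<Longrightarrow> available i q = Lhat u F i th"
proof -
  assume a: "others_agree q i th"
  then have "(SOME th. others_agree q i th) = th"
    using others_agree_same_state by (intro some_equality) blast+
  then show ?thesis using a by (auto simp: available_def)
qed

lemma menu_disagree: "(\<And>th. \<not> others_agree q i th) \<Longrightarrow> available i q = Delta (Zstar u F)"
  by (simp add: available_def)

lemma others_agree_upd [simp]: "others_agree (q(i := b)) i th \<longleftrightarrow> others_agree q i th"
  by (auto simp: others_agree_def)

lemma Lhat_subset: "Lhat u F i th \<subseteq> Delta (Zstar u F)"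
  using nonempty by (rule Lhat_subset_Delta_Zstar)

lemma outcome_in_Delta_Zstar: "outcome q \<in> Delta (Zstar u F)"
proof (cases "\<exists>i th. others_agree q i th")
  case True
  then obtain i th where a: "others_agree q i th" by blast
  show ?thesis
  proof (cases "assents th (q i)")
    case True
    then have "assents th (q j)" for j
      using a by (cases "j = i") (auto simp: others_agree_def)
    then have "outcome q = pmf_of_set (F th)" by (rule outcome_consensus)
    then show ?thesis
      using F_subset_Zstar[of F th u] nonempty by (simp add: Delta_def)
  next
    case False
    then show ?thesis
      using outcome_dissent[OF a] subsetD[OF Lhat_subset menu_mem[OF menu_c]] by simp
  qed
next
  case False
  then obtain i where "outcome q = d i (claim (q i)) (level (q i))"
    using outcome_contest by blast
  then show ?thesis using menu_mem[OF menu_d] by simp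
qed

lemma outcome_available: "outcome q \<in> available i q"
proof (cases "\<exists>th. others_agree q i th")
  case True
  then obtain th where a: "others_agree q i th" by blast
  show ?thesis
  proof (cases "assents th (q i)")
    case True
    then have "assents th (q j)" for j
      using a by (cases "j = i") (auto simp: others_agree_def)
    then show ?thesis
      using outcome_consensus menu_agree[OF a] uniform_in_Lhat nonempty by metis
  next
    case False
    then show ?thesis
      using outcome_dissent[OF a] menu_agree[OF a] menu_mem[OF menu_c] by simp
  qed
next
  case False
  then show ?thesis using outcome_in_Delta_Zstar menu_disagree by simp
qed

text \<open>A positive level never assents. If the others agree, \<open>i\<close> becomes the lone
  dissenter; if not, no other agent can be one, and \<open>i\<close> eventually has the strictly
  highest level.\<close>

lemma escalation_tendsto:
  "(\<lambda>k. EU (u i s) (outcome (q(i := (s, Suc k, s))))) \<longlonglongrightarrow> Sup (EU (u i s) ` available i q)"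
proof (cases "\<exists>th. others_agree q i th")
  case True
  then obtain th where a: "others_agree q i th" by blast
  have "outcome (q(i := (s, Suc k, s))) = c i th s (Suc k)" for k
    using a by (subst outcome_dissent[of _ i th]) (auto simp: assents_def claim_def level_def)
  then show ?thesis
    using LIMSEQ_Suc[OF menu_tendsto[OF menu_c]] by (simp add: menu_agree[OF a])
next
  case False
  have "outcome (q(i := (s, Suc k, s))) = d i s (Suc k)" if k: "k \<ge> Max (range (\<lambda>j. level (q j)))" for k
  proof -
    let ?q = "q(i := (s, Suc k, s))"
    have "\<not> others_agree ?q j th" for j th
    proof (cases "j = i")
      case True
      then show ?thesis using False by simp
    next
      case False
      then show ?thesis by (auto simp: others_agree_def assents_def)
    qed
    then obtain j where j: "\<And>l. level (?q l) \<le> level (?q j)" "outcome ?q = d j (claim (?q j)) (level (?q j))"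
      using outcome_contest by blast
    have "level (q j) \<le> k"
      using k by (meson Max_ge finite finite_imageI order_trans rangeI)
    have "j = i"
    proof (rule ccontr)
      assume "j \<noteq> i"
      then show False
        using j(1)[of i] \<open>level (q j) \<le> k\<close> by (simp add: level_def)
    qed
    then show ?thesis using j by (simp add: level_def claim_def)
  qed
  then have ev: "\<forall>\<^sub>F k in sequentially. EU (u i s) (d i s (Suc k)) = EU (u i s) (outcome (q(i := (s, Suc k, s))))"
    unfolding eventually_sequentially by metis
  have "(\<lambda>k. EU (u i s) (d i s (Suc k))) \<longlonglongrightarrow> Sup (EU (u i s) ` Delta (Zstar u F))"
    by (rule LIMSEQ_Suc[OF menu_tendsto[OF menu_d]])
  then show ?thesis
    using Lim_transform_eventually[OF _ ev] menu_disagree False by metis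
qed

definition g :: "('i \<Rightarrow> nat) \<Rightarrow> 'z pmf" where
  "g m = outcome (\<lambda>i. from_nat (m i))"

text \<open>Reporting the true state with ever higher integers guarantees in the limit the best
  available lottery against every profile of the others; hence in equilibrium the outcome is
  optimal profile by profile.\<close>

lemma equilibrium_optimal:
  assumes eq: "\<And>n. EU (u i s) (bind_pmf P (\<lambda>m. g (m(i := n)))) \<le> EU (u i s) (bind_pmf P g)"
    and m: "m \<in> set_pmf P"
  shows "EU (u i s) (g m) = Sup (EU (u i s) ` available i (\<lambda>j. from_nat (m j)))"
proof -
  let ?B = "\<lambda>m. Sup (EU (u i s) ` available i (\<lambda>j. from_nat (m j)))"
  \<comment> \<open>The deviation depends on \<open>k\<close> alone, so one pure message approaches
    the bound at all profiles in the support simultaneously.\<close>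
  define n where "n k = to_nat (s, Suc k, s)" for k
  have upd: "(\<lambda>j. from_nat ((m(i := n k)) j)) = (\<lambda>j. from_nat (m j))(i := (s, Suc k, s))"
    for m :: "'i \<Rightarrow> nat" and k
    by (auto simp: n_def)
  have lim: "(\<lambda>k. EU (u i s) (g (m(i := n k)))) \<longlonglongrightarrow> ?B m" for m
    unfolding g_def upd by (rule escalation_tendsto)
  \<comment> \<open>The uniform bound on utilities passes to the limit and makes \<open>?B\<close>
    integrable.\<close>
  have abs_B: "\<bar>?B m\<bar> \<le> (\<Sum>z\<in>UNIV. \<bar>u i s z\<bar>)" for m
    by (rule LIMSEQ_le_const2[OF tendsto_rabs[OF lim]]) (use EU_abs_le in blast)
  have "(\<lambda>k. measure_pmf.expectation P (\<lambda>m. EU (u i s) (g (m(i := n k)))))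
      \<longlonglongrightarrow> measure_pmf.expectation P ?B"
    by (rule integral_dominated_convergence[where w="\<lambda>_. \<Sum>z\<in>UNIV. \<bar>u i s z\<bar>"])
       (auto simp: lim EU_abs_le)
  moreover have "measure_pmf.expectation P (\<lambda>m. EU (u i s) (g (m(i := n k)))) \<le>
      measure_pmf.expectation P (\<lambda>m. EU (u i s) (g m))" for k
    using eq[of "n k"] by (simp add: EU_bind)
  ultimately have "measure_pmf.expectation P ?B \<le> measure_pmf.expectation P (\<lambda>m. EU (u i s) (g m))"
    by (intro LIMSEQ_le_const2) blast+
  then show ?thesis
    using m
    by (intro expectation_eq_pointwise[where P=P and f="\<lambda>m. EU (u i s) (g m)" and h="?B"]
        EU_pmf_integrable bounded_integrable_pmf[OF abs_B])
      (auto simp: g_def intro: EU_le_Sup outcome_available)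
qed

section \<open>Optimal profiles yield only outcomes in \<open>F s\<close>\<close>

lemma F_subset_by_mono:
  assumes "\<And>i. Lhat u F i th \<subseteq> LY (u i s) (pmf_of_set (F th))"
  shows "F th \<subseteq> F s"
  using mono assms unfolding unif_mono_def by blast

text \<open>If Z* is the union of the values of \<open>F\<close>, indifference on Z* triggers
  monotonicity from every state. Otherwise Z* is everything, and indifference would make it a max
  set, which is excluded.\<close>

lemma indifference_imp_Zstar_subset:
  assumes ind: "\<And>i z z'. z \<in> Zstar u F \<Longrightarrow> z' \<in> Zstar u F \<Longrightarrow> u i s z \<le> u i s z'"
  shows "Zstar u F \<subseteq> F s"
proof (cases "\<exists>i. imax_set u i UNIV")
  case True
  have "F th \<subseteq> F s" for th
  proof (rule F_subset_by_mono)
    fix i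
    obtain w where w: "w \<in> F th" using nonempty by blast
    then have wS: "w \<in> Zstar u F" using F_subset_Zstar[of F th u] by blast
    have const: "EU (u i s) y = u i s w" if "y \<in> Delta (Zstar u F)" for y
      using that by (intro EU_const antisym ind) (auto simp: Delta_def wS)
    show "Lhat u F i th \<subseteq> LY (u i s) (pmf_of_set (F th))"
    proof
      fix y assume "y \<in> Lhat u F i th"
      moreover have "pmf_of_set (F th) \<in> Lhat u F i th"
        using nonempty by (rule uniform_in_Lhat)
      ultimately have "EU (u i s) y = u i s w" "EU (u i s) (pmf_of_set (F th)) = u i s w"
        using Lhat_subset const by blast+
      then show "y \<in> LY (u i s) (pmf_of_set (F th))" by (simp add: LY_def)
    qed
  qed
  then show ?thesis using True by (auto simp: Zstar_def)
next
  case False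
  then have "Zstar u F = UNIV" by (simp add: Zstar_def)
  then have "u i s z \<le> u i s z'" for i z z'
    using ind by simp
  then have "imax_set u i UNIV" for i
    unfolding imax_set_def subset_argmax_on_iff by (auto intro: exI[of _ s])
  then show ?thesis using False by blast
qed

text \<open>Here \<open>G\<close> stands for the support of the outcome. If \<open>th\<close> is
  exceptional for \<open>i\<close>, the fixed-point equation of \<open>Xi\<close> applies; if only
  the minimum condition holds, \<open>s\<close> itself would make \<open>th\<close> exceptional; if
  that fails too, the indifference of \<open>i\<close> spreads to all of Z*.\<close>

lemma dissent_outcome_subset:
  assumes const: "\<And>y. y \<in> Lhat u F i th \<Longrightarrow> EU (u i s) y = b"
    and supp: "\<And>y. y \<in> Lhat u F i th \<Longrightarrow> set_pmf y \<subseteq> G"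
    and top: "\<And>j z z'. j \<noteq> i \<Longrightarrow> z \<in> G \<Longrightarrow> z' \<in> Zstar u F \<Longrightarrow> u j s z' \<le> u j s z"
    and p: "p \<in> Lhat u F i th"
  shows "set_pmf p \<subseteq> F s"
proof -
  let ?S = "Zstar u F" and ?D = "lower_outcomes u F i th" and ?v = "u i th"
  let ?unif = "pmf_of_set (F th)"
  have unif: "?unif \<in> Lhat u F i th"
    using nonempty by (rule uniform_in_Lhat)
  then have FG: "F th \<subseteq> G"
    using supp[OF unif] nonempty by simp
  have FS: "F th \<subseteq> F s"
  proof (rule F_subset_by_mono)
    fix j
    show "Lhat u F j th \<subseteq> LY (u j s) ?unif"
    proof (cases "j = i")
      case True
      then show ?thesis using const unif by (auto simp: LY_def)
    next
      case False
      show ?thesis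
      proof
        fix y assume "y \<in> Lhat u F j th"
        then have y: "set_pmf y \<subseteq> ?S" using Lhat_subset by (auto simp: Delta_def)
        obtain w where w: "w \<in> F th" using nonempty by blast
        then have wS: "w \<in> ?S" using F_subset_Zstar[of F th u] by blast
        have "EU (u j s) y \<le> u j s w"
          using y top[OF False] FG w by (intro EU_le) blast
        also have "\<dots> \<le> EU (u j s) ?unif"
          using top[OF False] FG nonempty wS by (intro EU_ge) auto
        finally show "y \<in> LY (u j s) ?unif" by (simp add: LY_def)
      qed
    qed
  qed
  have LamI: "s \<in> Lam u F i E" if E: "E \<noteq> {}" "E \<subseteq> ?S" "\<And>z. z \<in> E \<Longrightarrow> return_pmf z \<in> Lhat u F i th" for E
  proof -
    have "z \<in> G" "u i s z = b" if "z \<in> E" for z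
      using supp[OF E(3)[OF that]] const[OF E(3)[OF that]] by auto
    then show ?thesis
      using E top unfolding mem_Lam_iff by (metis order_refl)
  qed
  have "F th \<subseteq> ?S" by (rule F_subset_Zstar)
  have ThetaI_I: "t \<in> ThetaI u F i th" if "t \<in> Lam u F i ?D" "F th \<subseteq> F t" "F th \<subseteq> ?D" for t
    using that Lam_antimono[OF nonempty that(3), of u F i] by (auto simp: ThetaI_def Lam_def)
  consider "exceptional u F i th" | "\<not> exceptional u F i th" "F th \<subseteq> argmin_on ?v ?S"
    | "\<not> exceptional u F i th" "\<not> F th \<subseteq> argmin_on ?v ?S"
    by blast
  then show ?thesis
  proof cases
    case 1
    define C where "C = Lsupport u F i th"
    have Lh: "Lhat u F i th = Delta C"
      using 1 by (simp add: Lhat_def Lsupport_def exceptional_def Int_assoc C_def)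
    have bad: "F th \<subseteq> argmin_on ?v ?S"
      using 1 by (simp add: exceptional_def)
    then have FD: "F th \<subseteq> ?D" by (rule F_subset_lower_outcomes)
    obtain th1 where th1: "th1 \<in> Lam u F i ?D"
      using 1 by (auto simp: exceptional_def)
    \<comment> \<open>At \<open>th1\<close> the outcomes in \<open>F th\<close> are best for
      \<open>i\<close> within \<open>?D\<close> and for the others within Z*, so monotonicity
      applies.\<close>
    have "F th \<subseteq> F th1"
    proof (rule F_subset_by_mono)
      fix j
      obtain w where w: "w \<in> F th" using nonempty by blast
      have supp_j: "set_pmf y \<subseteq> (if j = i then ?D else ?S)" if "y \<in> Lhat u F j th" for y
        using that Lhat_subset[of j th] Lh 1
        by (auto simp: Delta_def C_def Lsupport_def)
      have top1: "u j th1 z' \<le> u j th1 z" if "z \<in> ?D" "z' \<in> (if j = i then ?D else ?S)" for z z'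
        using th1 that unfolding mem_Lam_iff by (cases "j = i") auto
      show "Lhat u F j th \<subseteq> LY (u j th1) ?unif"
      proof
        fix y assume y: "y \<in> Lhat u F j th"
        have "EU (u j th1) y \<le> u j th1 w"
          using supp_j[OF y] top1 FD w by (intro EU_le) blast
        also have "\<dots> \<le> EU (u j th1) ?unif"
          using FD w nonempty \<open>F th \<subseteq> ?S\<close> by (intro EU_ge top1) auto
        finally show "y \<in> LY (u j th1) ?unif" by (simp add: LY_def)
      qed
    qed
    then have th1T: "th1 \<in> ThetaI u F i th"
      using ThetaI_I th1 FD by blast
    obtain K0 where K0: "K0 \<in> Xi u F i th" and
      least: "\<And>K. K \<subseteq> ThetaI u F i th \<Longrightarrow>
        ThetaI u F i th \<inter> Lam u F i (?D \<inter> (\<Inter>th'\<in>K. F th')) \<subseteq> K \<Longrightarrow> K0 \<subseteq> K"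
      using least_Xi[OF nonempty FD th1T th1] by metis
    \<comment> \<open>As \<open>K0\<close> is least in \<open>Xi\<close>, its intersection is the
      largest, and the union in \<open>Lsupport\<close> collapses to it.\<close>
    have "K0 \<subseteq> K" if "K \<in> Xi u F i th" for K
      using that by (intro least) (auto simp: Xi_def)
    then have "(\<Union>K\<in>Xi u F i th. \<Inter>th'\<in>K. F th') = (\<Inter>th'\<in>K0. F th')"
      using K0 by blast
    then have C: "C = ?D \<inter> (\<Inter>th'\<in>K0. F th')"
      using 1 by (simp add: C_def Lsupport_def)
    have FC: "F th \<subseteq> C"
      unfolding C_def by (rule F_subset_Lsupport)
    have sC: "s \<in> Lam u F i C"
      using FC nonempty[of th] Lh Lsupport_subset_Zstar[of u F i th]
      by (intro LamI) (auto simp: C_def return_in_Delta)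
    have "s \<in> Lam u F i (F th)"
      using sC Lam_antimono[OF nonempty FC, of u F i] by blast
    then have "s \<in> ThetaI u F i th"
      using FS by (auto simp: ThetaI_def Lam_def)
    \<comment> \<open>The fixed-point equation of \<open>K0\<close>, read from left to
      right.\<close>
    then have "s \<in> K0"
      using K0 sC unfolding C Xi_def by blast
    then have "C \<subseteq> F s" unfolding C by blast
    then show ?thesis using p Lh by (auto simp: Delta_def)
  next
    case 2
    have FD: "F th \<subseteq> ?D" using 2 by (intro F_subset_lower_outcomes)
    have "return_pmf z \<in> Lhat u F i th" if z: "z \<in> ?D" for z
    proof -
      have "?v z \<le> EU ?v ?unif"
        using z nonempty by (intro EU_ge) (auto simp: LZset_eq)
      then show ?thesis
        using 2 z nonempty by (simp add: Lhat_eq Lsupport_def LY_def return_in_Delta)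
    qed
    then have sD: "s \<in> Lam u F i ?D"
      using FD nonempty[of th] by (intro LamI) auto
    then have "s \<in> ThetaI u F i th"
      using ThetaI_I FS FD by blast
    then obtain K0 where "K0 \<in> Xi u F i th"
      using least_Xi[OF nonempty FD _ sD] by metis
    then have "exceptional u F i th"
      using 2 sD by (auto simp: exceptional_def)
    then show ?thesis using 2 by blast
  next
    case 3
    have Lh: "Lhat u F i th = Delta ?S \<inter> LY ?v ?unif"
      using 3 nonempty by (simp add: Lhat_eq Lsupport_def)
    obtain w z0 where w: "w \<in> F th" and z0: "z0 \<in> ?S" "?v z0 < ?v w"
      using 3 \<open>F th \<subseteq> ?S\<close> by (force simp: argmin_on_def)
    \<comment> \<open>If every outcome in Z* were at least as good as the uniform lottery,
      \<open>F th\<close> would consist of minimisers.\<close>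
    obtain a where a: "a \<in> ?S" "?v a < EU ?v ?unif"
    proof (rule ccontr)
      assume "\<not> thesis"
      then have ge: "EU ?v ?unif \<le> ?v x" if "x \<in> ?S" for x
        using that \<open>\<And>a. a \<in> ?S \<Longrightarrow> ?v a < EU ?v ?unif \<Longrightarrow> thesis\<close> by force
      then have "?v w = EU ?v ?unif"
        using w \<open>F th \<subseteq> ?S\<close> nonempty by (intro EU_min_imp_const[of ?unif]) auto
      then show False using ge[OF z0(1)] z0(2) by simp
    qed
    have all: "z \<in> G \<and> u i s z = b" if z: "z \<in> ?S" for z
    proof -
      \<comment> \<open>Weight on \<open>z\<close> that keeps the mixture with \<open>a\<close> in
        the contour set: any weight in (0,1] does if \<open>z\<close> is no better than the uniform
        lottery, otherwise the one giving equality.\<close>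
      define e where "e = (if ?v z \<le> EU ?v ?unif then 1/2
        else (EU ?v ?unif - ?v a) / (?v z - ?v a))"
      have e: "0 < e" "e \<le> 1" "?v z * e + ?v a * (1 - e) \<le> EU ?v ?unif"
      proof -
        show "0 < e" "e \<le> 1" using a by (auto simp: e_def)
        show "?v z * e + ?v a * (1 - e) \<le> EU ?v ?unif"
        proof (cases "?v z \<le> EU ?v ?unif")
          case True
          then show ?thesis using a by (simp add: e_def)
        next
          case False
          then have "(?v z - ?v a) * e = EU ?v ?unif - ?v a"
            using a by (simp add: e_def)
          then show ?thesis by (simp add: algebra_simps)
        qed
      qed
      define y where "y = bind_pmf (bernoulli_pmf e) (\<lambda>x. return_pmf (if x then z else a))"
      have EUy: "EU v y = v z * e + v a * (1 - e)" for v
        using e by (simp add: y_def EU_bind)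
      have y: "y \<in> Lhat u F i th"
        using z a e by (auto simp: Lh Delta_def LY_def EUy) (auto simp: y_def split: if_splits)
      have "return_pmf a \<in> Lhat u F i th"
        using a by (simp add: Lh return_in_Delta LY_def)
      then have "u i s a = b" using const by fastforce
      moreover have "u i s z * e + u i s a * (1 - e) = b"
        using const[OF y] by (simp add: EUy)
      ultimately have "(u i s z - b) * e = 0"
        by (simp add: algebra_simps)
      then have "u i s z = b" using e by simp
      moreover have "True \<in> set_pmf (bernoulli_pmf e)"
        using e by (simp add: set_pmf_iff)
      then have "z \<in> set_pmf y" unfolding y_def by force
      ultimately show ?thesis using supp[OF y] by blast
    qed
    have "?S \<subseteq> F s"
    proof (rule indifference_imp_Zstar_subset)
      fix j z z' assume "z \<in> ?S" "z' \<in> ?S"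
      then show "u j s z \<le> u j s z'"
        using all top[of j z' z] by (cases "j = i") auto
    qed
    then show ?thesis using p Lhat_subset[of i th] by (auto simp: Delta_def)
  qed
qed

text \<open>In a contest the support covers Z*, so all are indifferent on it; under consensus,
  optimality is the premise of monotonicity; for a lone dissenter, \<open>menu_indifferent\<close>
  supplies indifference on the menu.\<close>

lemma optimal_outcome_subset:
  assumes opt: "\<And>i. EU (u i s) (outcome q) = Sup (EU (u i s) ` available i q)"
  shows "set_pmf (outcome q) \<subseteq> F s"
proof -
  let ?S = "Zstar u F"
  \<comment> \<open>An agent facing others who disagree has all lotteries on Z* available, so the
    outcome is supported on its best outcomes.\<close>
  have top: "u j s z' \<le> u j s z"
    if "\<And>th. \<not> others_agree q j th" "z \<in> set_pmf (outcome q)" "z' \<in> ?S" for j z z'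
    using opt[of j] outcome_in_Delta_Zstar[of q] that
    by (intro Delta_optimal[of "u j s" "outcome q" ?S]) (auto simp: menu_disagree Delta_def)
  show ?thesis
  proof (cases "\<exists>i th. others_agree q i th")
    case False
    then obtain i where "outcome q = d i (claim (q i)) (level (q i))"
      using outcome_contest by blast
    then have full: "?S \<subseteq> set_pmf (outcome q)"
      using menu_support[OF menu_d return_in_Delta] by auto
    have "?S \<subseteq> F s"
      by (rule indifference_imp_Zstar_subset) (use top False full in blast)
    then show ?thesis using outcome_in_Delta_Zstar[of q] by (auto simp: Delta_def)
  next
    case True
    then obtain i th where a: "others_agree q i th" by blast
    show ?thesis
    proof (cases "assents th (q i)")
      case True
      then have all: "assents th (q j)" for j
        using a by (cases "j = i") (auto simp: others_agree_def)
      then have out: "outcome q = pmf_of_set (F th)" by (rule outcome_consensus)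
      have "F th \<subseteq> F s"
      proof (rule F_subset_by_mono)
        fix j
        have "available j q = Lhat u F j th"
          using all by (intro menu_agree) (simp add: others_agree_def)
        then show "Lhat u F j th \<subseteq> LY (u j s) (pmf_of_set (F th))"
          using opt[of j] EU_le_Sup[of _ "Lhat u F j th" "u j s"] by (auto simp: LY_def out)
      qed
      then show ?thesis using out nonempty by simp
    next
      case False
      have out: "outcome q = c i th (claim (q i)) (level (q i))"
        using a False by (rule outcome_dissent)
      show ?thesis
      proof (rule dissent_outcome_subset)
        show "EU (u i s) y = Sup (EU (u i s) ` Lhat u F i th)" if "y \<in> Lhat u F i th" for y
          using opt[of i] that unfolding menu_agree[OF a] out by (rule menu_indifferent[OF menu_c])
        show "set_pmf y \<subseteq> set_pmf (outcome q)" if "y \<in> Lhat u F i th" for y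
          using that unfolding out by (rule menu_support[OF menu_c])
        show "u j s z' \<le> u j s z" if "j \<noteq> i" "z \<in> set_pmf (outcome q)" "z' \<in> ?S" for j z z'
          using that others_agree_unique_dissenter[OF a False] by (intro top) auto
        show "outcome q \<in> Lhat u F i th"
          unfolding out by (rule menu_mem[OF menu_c])
      qed
    qed
  qed
qed

text \<open>\<open>P\<close> need not be a product, so this covers mixed profiles and, through point
  masses, pure ones.\<close>

lemma equilibrium_outcome_subset:
  assumes "\<And>i n. EU (u i s) (bind_pmf P (\<lambda>m. g (m(i := n)))) \<le> EU (u i s) (bind_pmf P g)"
  shows "set_pmf (bind_pmf P g) \<subseteq> F s"
proof -
  have "set_pmf (g m) \<subseteq> F s" if "m \<in> set_pmf P" for m
    unfolding g_def
    by (rule optimal_outcome_subset) (use equilibrium_optimal[OF assms that] in \<open>simp add: g_def\<close>)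
  then show ?thesis by auto
qed

lemma MNE_outcome_subset:
  assumes "lam \<in> MNE (\<lambda>_. UNIV) g u s"
  shows "set_pmf (induced g lam) \<subseteq> F s"
  unfolding induced_def
proof (rule equilibrium_outcome_subset)
  fix i n
  have "EU (u i s) (induced g (lam(i := return_pmf n))) \<le> EU (u i s) (induced g lam)"
    using assms by (simp add: MNE_def)
  then show "EU (u i s) (bind_pmf (Pi_pmf UNIV 0 lam) (\<lambda>m. g (m(i := n)))) \<le>
      EU (u i s) (bind_pmf (Pi_pmf UNIV 0 lam) g)"
    by (simp add: induced_def Pi_pmf_upd_return bind_map_pmf)
qed

lemma PNE_outcome_subset:
  assumes "m \<in> PNE (\<lambda>_. UNIV) g u s"
  shows "set_pmf (g m) \<subseteq> F s"
  using equilibrium_outcome_subset[of s "return_pmf m"] assms by (simp add: PNE_def bind_return_pmf)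

section \<open>Truth-telling is an equilibrium\<close>

definition truth :: "'th \<Rightarrow> 'i \<Rightarrow> nat" where
  "truth s = (\<lambda>_. to_nat (s, 0 :: nat, s))"

lemma g_truth: "g (truth s) = pmf_of_set (F s)"
  unfolding g_def truth_def by (rule outcome_consensus) (simp add: assents_def)

text \<open>A lone deviator stays within its \<open>Lhat\<close>, which lies in the contour set of
  the uniform lottery.\<close>

lemma truth_deviation: "EU (u i s) (g ((truth s)(i := n))) \<le> EU (u i s) (g (truth s))"
proof -
  let ?q = "\<lambda>j. from_nat (((truth s)(i := n)) j) :: 'th ballot"
  have "others_agree ?q i s"
    by (auto simp: others_agree_def truth_def assents_def)
  then have "g ((truth s)(i := n)) \<in> Lhat u F i s"
    using outcome_available[of ?q i] menu_agree[of ?q i s] by (simp add: g_def)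
  then show ?thesis
    using nonempty by (simp add: Lhat_eq LY_def g_truth)
qed

lemma truth_PNE: "truth s \<in> PNE (\<lambda>_. UNIV) g u s"
  by (simp add: PNE_def truth_deviation)

lemma truth_MNE: "(\<lambda>i. return_pmf (truth s i)) \<in> MNE (\<lambda>_. UNIV) g u s"
  and induced_truth: "induced g (\<lambda>i. return_pmf (truth s i)) = pmf_of_set (F s)"
proof -
  show ind: "induced g (\<lambda>i. return_pmf (truth s i)) = pmf_of_set (F s)"
    by (simp add: induced_def bind_return_pmf g_truth)
  show "(\<lambda>i. return_pmf (truth s i)) \<in> MNE (\<lambda>_. UNIV) g u s"
    unfolding MNE_def
  proof (intro CollectI conjI allI impI)
    fix i mu
    show "EU (u i s) (induced g ((\<lambda>i. return_pmf (truth s i))(i := mu)))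
        \<le> EU (u i s) (induced g (\<lambda>i. return_pmf (truth s i)))"
      unfolding ind unfolding induced_def
    proof (rule EU_bind_le)
      \<comment> \<open>Every profile drawn under a mixed deviation is a pure deviation from
        \<open>truth s\<close>, so the pure bound survives averaging.\<close>
      fix m assume "m \<in> set_pmf (Pi_pmf UNIV 0 ((\<lambda>i. return_pmf (truth s i))(i := mu)))"
      then have "m j \<in> set_pmf (((\<lambda>i. return_pmf (truth s i))(i := mu)) j)" for j
        by (auto simp: set_Pi_pmf PiE_dflt_def)
      then have "m j = truth s j" if "j \<noteq> i" for j
        using that by (metis fun_upd_other set_return_pmf singletonD)
      then have "m = (truth s)(i := m i)" by auto
      then show "EU (u i s) (g m) \<le> EU (u i s) (pmf_of_set (F s))"
        using truth_deviation[of i s "m i"] by (simp add: g_truth)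
    qed
  qed simp
qed

lemma implements: "mixedB_impl u F"
proof -
  have "(\<Union>lam\<in>MNE (\<lambda>_. UNIV) g u s. set_pmf (induced g lam)) = F s" for s
  proof
    show "(\<Union>lam\<in>MNE (\<lambda>_. UNIV) g u s. set_pmf (induced g lam)) \<subseteq> F s"
      using MNE_outcome_subset by (rule UN_least)
    show "F s \<subseteq> (\<Union>lam\<in>MNE (\<lambda>_. UNIV) g u s. set_pmf (induced g lam))"
      using UN_upper[OF truth_MNE, of "\<lambda>lam. set_pmf (induced g lam)" s] nonempty
      by (simp add: induced_truth)
  qed
  moreover have "(\<Union>m\<in>PNE (\<lambda>_. UNIV) g u s. set_pmf (g m)) = F s" for s
  proof
    show "(\<Union>m\<in>PNE (\<lambda>_. UNIV) g u s. set_pmf (g m)) \<subseteq> F s"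
      using PNE_outcome_subset by (rule UN_least)
    show "F s \<subseteq> (\<Union>m\<in>PNE (\<lambda>_. UNIV) g u s. set_pmf (g m))"
      using UN_upper[OF truth_PNE, of "\<lambda>m. set_pmf (g m)" s] nonempty
      by (simp add: g_truth)
  qed
  ultimately show ?thesis
    unfolding mixedB_impl_def by (intro exI[of _ "\<lambda>_. UNIV"] exI[of _ g]) auto
qed

end

lemma unif_mono_imp_mixedB_impl:
  fixes u :: "'i::finite \<Rightarrow> 'th::countable \<Rightarrow> 'z::finite \<Rightarrow> real"
  assumes "CARD('i) \<ge> 3" and ne: "\<And>th. F th \<noteq> {}" and "unif_mono u F"
  shows "mixedB_impl u F"
proof -
  have "\<exists>c. menu (u i) (Lhat u F i th) c" for i th
    by (rule ex_menu[OF Lhat_eq[of F th u i]]) (use ne uniform_in_Lhat[of F th u i] in auto)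
  then obtain c where c: "\<And>i th. menu (u i) (Lhat u F i th) (c i th)"
    by metis
  have "Delta (Zstar u F) \<noteq> {}"
    using Lhat_subset_Delta_Zstar[of F _ u] uniform_in_Lhat[of F _ u] ne by blast
  then have "\<exists>d. menu (u i) (Delta (Zstar u F)) d" for i
    by (rule ex_menu[OF Delta_eq_contour])
  then obtain d where d: "\<And>i. menu (u i) (Delta (Zstar u F)) (d i)"
    by metis
  interpret canonical_mechanism u F c d
    by unfold_locales (use assms c d in auto)
  show ?thesis by (rule implements)
qed

theorem theorem6:
  fixes u :: "'i::finite \<Rightarrow> 'th::countable \<Rightarrow> 'z::finite \<Rightarrow> real"
    and F :: "'th \<Rightarrow> 'z set"
  assumes "CARD('i) \<ge> 3"
    and "\<forall>th. F th \<noteq> {}"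
  shows "(mixedA_impl u F \<longleftrightarrow> mixedB_impl u F) \<and> (mixedB_impl u F \<longleftrightarrow> unif_mono u F)"
proof -
  have "mixedB_impl u F \<Longrightarrow> mixedA_impl u F"
    unfolding mixedA_impl_def mixedB_impl_def by metis
  moreover have "mixedA_impl u F \<Longrightarrow> unif_mono u F"
    using assms(2) by (intro mixedA_impl_imp_unif_mono) auto
  moreover have "unif_mono u F \<Longrightarrow> mixedB_impl u F"
    using assms by (intro unif_mono_imp_mixedB_impl) auto
  ultimately show ?thesis by blast
qed

end
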